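(* Let $J\dashv_{\mathcal{P}}K$ be a parametric adjunction, with $J:\mathcal{C}\times\mathcal{P}\to\mathcal{D}$ and $K:\mathcal{P}^{op}\times\mathcal{D}\to\mathcal{C}$, and let $(J,\psi^{J}):(\mathcal{C}\times\mathcal{P},S\times E)\to(\mathcal{D},T)$ be a left Hopf 1-cell in $\mathbf{Mnd}(\mathbf{Cat})$. Then (i) $(J(\mathcal{C}\times U^{E}),\psi^{JU^{E}}):(\mathcal{C}\times\mathcal{P}^{E},S\times\mathcal{P}^{E})\to(\mathcal{D},T)$ and (ii) $(K((U^{E})^{op}\times\mathcal{D}),\psi^{KU^{E}}):((\mathcal{P}^{E})^{op}\times\mathcal{D},(\mathcal{P}^{E})^{op}\times T)\to(\mathcal{C},S)$ are 1-cells in $\mathbf{Mnd}(\mathbf{Cat})$, and for each $(M,k_M)$ in $\mathcal{P}^{E}$ there is an adjoint object in $\mathbf{Mnd}(\mathbf{Cat})$ $$(J_M,\psi^{JM})\dashv(K_M,\psi^{KM}).$$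
   Context: All categories are small. A category name also denotes its identity functor; juxtaposition denotes composition and whiskering. $(\mathcal{C},S)$, $(\mathcal{D},T)$, $(\mathcal{P},E)$ are monads; $\mathcal{P}^E$ is the Eilenberg–Moore category of $E$, with objects $(M,k_M)$ and forgetful functor $U^E:\mathcal{P}^E\to\mathcal{P}$. $\mathbf{Mnd}(\mathbf{Cat})$: 0-cells are monads; a 1-cell $(B,\psi):(\mathcal{C},S)\to(\mathcal{D},T)$ is a functor $B:\mathcal{C}\to\mathcal{D}$ with $\psi:TB\to BS$ satisfying $\psi\circ\mu^TB=B\mu^S\circ\psi S\circ T\psi$ and $\psi\circ\eta^TB=B\eta^S$; a 2-cell $(A,\psi^A)\to(B,\psi^B)$ is $\theta:A\to B$ with $\psi^B\circ T\theta=\theta S\circ\psi^A$; composites are $(K,\psi^K)(J,\psi^J)=(KJ,K\psi^J\circ\psi^KJ)$. An adjoint object $(J,\psi^J)\dashv(K,\psi^K)$ is an adjunction $J\dashv K$ whose unit and counit are 2-cells. Parametric adjunction $J\dashv_{\mathcal{P}}K$: for each $P$ an adjunction $J_P=J(-,P)\dashv K_P=K(P,-)$ with unit $\eta^P$, counit $\varepsilon^P$, such that for $p:P\to P'$, $K_{p^{op}}=K_P\varepsilon^{P'}\circ K_PJ_pK_{P'}\circ\eta^PK_{P'}$. $H(\psi^J):TJ(\mathcal{C}\times U^E)\to J(S\times U^E)$ has component $J(SC,k_M)\circ\psi^J_{(C,M)}:TJ(C,M)\to J(SC,M)$ at $(C,(M,k_M))$; $(J,\psi^J)$ is left Hopf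 if $H(\psi^J)$ is invertible. Write $\psi^{JU^E}=H(\psi^J)$, and for $(M,k_M)$ in $\mathcal{P}^E$ write $\psi^{JM}=H(\psi^J)_{(-,(M,k_M))}:TJ_M\to J_MS$ and $$\psi^{KM}=K_MT\varepsilon^{M}\circ K_M(\psi^{JM})^{-1}K_M\circ\eta^{M}SK_M:SK_M\to K_MT .$$ $\psi^{KU^E}:SK((U^E)^{op}\times\mathcal{D})\to K((U^E)^{op}\times T)$ is the transformation with components $\psi^{KU^E}((M,k_M),D)=\psi^{KM}_D$. (The paper calls the resulting structure a Hopf parametric adjoint object in $\mathbf{Mnd}(\mathbf{Cat})$.) *)

theory Defs
  imports Main
begin

text \<open>
  Small categories are carrier-based: objects and arrows form sets inside arbitrary types.
  Functors and transformations are only constrained on these carriers; their values elsewhere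
  are irrelevant to every predicate below.
\<close>

section \<open>Categories, functors and natural transformations\<close>

record ('o, 'a) cat =
  Obj :: "'o set"
  Arr :: "'a set"
  Dom :: "'a \<Rightarrow> 'o"
  Cod :: "'a \<Rightarrow> 'o"
  Idn :: "'o \<Rightarrow> 'a"
  Cmp :: "'a \<Rightarrow> 'a \<Rightarrow> 'a"  (infixr "\<cdot>\<index>" 70)

definition Hom :: "('o, 'a) cat \<Rightarrow> 'o \<Rightarrow> 'o \<Rightarrow> 'a set" where
  "Hom C x y = {f \<in> Arr C. Dom C f = x \<and> Cod C f = y}"

locale category =
  fixes C :: "('o, 'a) cat"
  assumes Dom_closed: "f \<in> Arr C \<Longrightarrow> Dom C f \<in> Obj C"
    and Cod_closed: "f \<in> Arr C \<Longrightarrow> Cod C f \<in> Obj C"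
    and Idn_Hom: "x \<in> Obj C \<Longrightarrow> Idn C x \<in> Hom C x x"
    and Cmp_Hom: "f \<in> Hom C x y \<Longrightarrow> g \<in> Hom C y z \<Longrightarrow> g \<cdot>\<^bsub>C\<^esub> f \<in> Hom C x z"
    and Idn_left: "f \<in> Hom C x y \<Longrightarrow> Idn C y \<cdot>\<^bsub>C\<^esub> f = f"
    and Idn_right: "f \<in> Hom C x y \<Longrightarrow> f \<cdot>\<^bsub>C\<^esub> Idn C x = f"
    and Cmp_assoc: "f \<in> Hom C w x \<Longrightarrow> g \<in> Hom C x y \<Longrightarrow> h \<in> Hom C y z \<Longrightarrow>
      (h \<cdot>\<^bsub>C\<^esub> g) \<cdot>\<^bsub>C\<^esub> f = h \<cdot>\<^bsub>C\<^esub> (g \<cdot>\<^bsub>C\<^esub> f)"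

definition inverse_arrows :: "('o, 'a) cat \<Rightarrow> 'a \<Rightarrow> 'a \<Rightarrow> bool" where
  "inverse_arrows C f g \<longleftrightarrow>
     f \<in> Arr C \<and> g \<in> Hom C (Cod C f) (Dom C f) \<and>
     g \<cdot>\<^bsub>C\<^esub> f = Idn C (Dom C f) \<and> f \<cdot>\<^bsub>C\<^esub> g = Idn C (Cod C f)"

definition inv_arrow :: "('o, 'a) cat \<Rightarrow> 'a \<Rightarrow> 'a" where
  "inv_arrow C f = (THE g. inverse_arrows C f g)"

definition op_cat :: "('o, 'a) cat \<Rightarrow> ('o, 'a) cat" where
  "op_cat C = \<lparr>Obj = Obj C, Arr = Arr C, Dom = Cod C, Cod = Dom C, Idn = Idn C,
     Cmp = (\<lambda>g f. f \<cdot>\<^bsub>C\<^esub> g)\<rparr>"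

definition prod_cat :: "('o, 'a) cat \<Rightarrow> ('p, 'b) cat \<Rightarrow> ('o \<times> 'p, 'a \<times> 'b) cat" where
  "prod_cat C D = \<lparr>Obj = Obj C \<times> Obj D, Arr = Arr C \<times> Arr D,
     Dom = map_prod (Dom C) (Dom D), Cod = map_prod (Cod C) (Cod D),
     Idn = map_prod (Idn C) (Idn D),
     Cmp = (\<lambda>(g, g') (f, f'). (g \<cdot>\<^bsub>C\<^esub> f, g' \<cdot>\<^bsub>D\<^esub> f'))\<rparr>"

record ('o, 'a, 'p, 'b) ftor =
  FObj :: "'o \<Rightarrow> 'p"
  FArr :: "'a \<Rightarrow> 'b"

locale cat_functor = dom: category C + cod: category D
  for C :: "('o, 'a) cat" and D :: "('p, 'b) cat" +
  fixes F :: "('o, 'a, 'p, 'b) ftor"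
  assumes FObj_closed: "x \<in> Obj C \<Longrightarrow> FObj F x \<in> Obj D"
    and FArr_Hom: "f \<in> Hom C x y \<Longrightarrow> FArr F f \<in> Hom D (FObj F x) (FObj F y)"
    and FArr_Idn: "x \<in> Obj C \<Longrightarrow> FArr F (Idn C x) = Idn D (FObj F x)"
    and FArr_Cmp: "f \<in> Hom C x y \<Longrightarrow> g \<in> Hom C y z \<Longrightarrow>
      FArr F (g \<cdot>\<^bsub>C\<^esub> f) = FArr F g \<cdot>\<^bsub>D\<^esub> FArr F f"

definition id_ftor :: "('o, 'a, 'o, 'a) ftor" where
  "id_ftor = \<lparr>FObj = id, FArr = id\<rparr>"

definition comp_ftor ::
  "('p, 'b, 'q, 'c) ftor \<Rightarrow> ('o, 'a, 'p, 'b) ftor \<Rightarrow> ('o, 'a, 'q, 'c) ftor"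
  (infixr "\<circ>\<^sub>F" 70) where
  "G \<circ>\<^sub>F F = \<lparr>FObj = FObj G \<circ> FObj F, FArr = FArr G \<circ> FArr F\<rparr>"

definition prod_ftor ::
  "('o, 'a, 'p, 'b) ftor \<Rightarrow> ('o', 'a', 'p', 'b') ftor \<Rightarrow>
   ('o \<times> 'o', 'a \<times> 'a', 'p \<times> 'p', 'b \<times> 'b') ftor"
  (infixr "\<times>\<^sub>F" 75) where
  "F \<times>\<^sub>F G = \<lparr>FObj = map_prod (FObj F) (FObj G), FArr = map_prod (FArr F) (FArr G)\<rparr>"

text \<open>
  An arrow of the opposite category is represented by the same element as in the original one,
  so the opposite of a functor has the same underlying maps.
\<close>

definition op_ftor :: "('o, 'a, 'p, 'b) ftor \<Rightarrow> ('o, 'a, 'p, 'b) ftor" where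
  "op_ftor F = F"

locale nat_trans = source: cat_functor C D F + target: cat_functor C D G
  for C :: "('o, 'a) cat" and D :: "('p, 'b) cat"
    and F :: "('o, 'a, 'p, 'b) ftor" and G :: "('o, 'a, 'p, 'b) ftor" +
  fixes \<tau> :: "'o \<Rightarrow> 'b"
  assumes component_Hom: "x \<in> Obj C \<Longrightarrow> \<tau> x \<in> Hom D (FObj F x) (FObj G x)"
    and naturality: "f \<in> Hom C x y \<Longrightarrow> \<tau> y \<cdot>\<^bsub>D\<^esub> FArr F f = FArr G f \<cdot>\<^bsub>D\<^esub> \<tau> x"

definition invertible_trans ::
  "('o, 'a) cat \<Rightarrow> ('p, 'b) cat \<Rightarrow> ('o, 'a, 'p, 'b) ftor \<Rightarrow> ('o, 'a, 'p, 'b) ftor \<Rightarrow>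
   ('o \<Rightarrow> 'b) \<Rightarrow> bool" where
  "invertible_trans C D F G \<tau> \<longleftrightarrow>
     nat_trans C D F G \<tau> \<and>
     (\<exists>\<sigma>. nat_trans C D G F \<sigma> \<and>
        (\<forall>x\<in>Obj C. \<sigma> x \<cdot>\<^bsub>D\<^esub> \<tau> x = Idn D (FObj F x) \<and> \<tau> x \<cdot>\<^bsub>D\<^esub> \<sigma> x = Idn D (FObj G x)))"

definition adjunction ::
  "('o, 'a) cat \<Rightarrow> ('p, 'b) cat \<Rightarrow> ('o, 'a, 'p, 'b) ftor \<Rightarrow> ('p, 'b, 'o, 'a) ftor \<Rightarrow>
   ('o \<Rightarrow> 'a) \<Rightarrow> ('p \<Rightarrow> 'b) \<Rightarrow> bool" where
  "adjunction C D J K \<eta> \<epsilon> \<longleftrightarrow>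
     cat_functor C D J \<and> cat_functor D C K \<and>
     nat_trans C C id_ftor (K \<circ>\<^sub>F J) \<eta> \<and>
     nat_trans D D (J \<circ>\<^sub>F K) id_ftor \<epsilon> \<and>
     (\<forall>x\<in>Obj C. \<epsilon> (FObj J x) \<cdot>\<^bsub>D\<^esub> FArr J (\<eta> x) = Idn D (FObj J x)) \<and>
     (\<forall>y\<in>Obj D. FArr K (\<epsilon> y) \<cdot>\<^bsub>C\<^esub> \<eta> (FObj K y) = Idn C (FObj K y))"


section \<open>Monads and the 2-category of monads\<close>

record ('o, 'a) mnd =
  Cat :: "('o, 'a) cat"
  Fun :: "('o, 'a, 'o, 'a) ftor"
  Unt :: "'o \<Rightarrow> 'a"
  Mul :: "'o \<Rightarrow> 'a"

locale monad =
  fixes S :: "('o, 'a) mnd"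
  assumes Cat_category: "category (Cat S)"
    and Fun_functor: "cat_functor (Cat S) (Cat S) (Fun S)"
    and Unt_nat: "nat_trans (Cat S) (Cat S) id_ftor (Fun S) (Unt S)"
    and Mul_nat: "nat_trans (Cat S) (Cat S) (Fun S \<circ>\<^sub>F Fun S) (Fun S) (Mul S)"
    and Mul_assoc: "x \<in> Obj (Cat S) \<Longrightarrow>
      Mul S x \<cdot>\<^bsub>Cat S\<^esub> FArr (Fun S) (Mul S x) = Mul S x \<cdot>\<^bsub>Cat S\<^esub> Mul S (FObj (Fun S) x)"
    and Unt_left: "x \<in> Obj (Cat S) \<Longrightarrow>
      Mul S x \<cdot>\<^bsub>Cat S\<^esub> Unt S (FObj (Fun S) x) = Idn (Cat S) (FObj (Fun S) x)"
    and Unt_right: "x \<in> Obj (Cat S) \<Longrightarrow>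
      Mul S x \<cdot>\<^bsub>Cat S\<^esub> FArr (Fun S) (Unt S x) = Idn (Cat S) (FObj (Fun S) x)"

definition id_mnd :: "('o, 'a) cat \<Rightarrow> ('o, 'a) mnd" where
  "id_mnd C = \<lparr>Cat = C, Fun = id_ftor, Unt = Idn C, Mul = Idn C\<rparr>"

definition prod_mnd :: "('o, 'a) mnd \<Rightarrow> ('p, 'b) mnd \<Rightarrow> ('o \<times> 'p, 'a \<times> 'b) mnd" where
  "prod_mnd S T = \<lparr>Cat = prod_cat (Cat S) (Cat T), Fun = Fun S \<times>\<^sub>F Fun T,
     Unt = map_prod (Unt S) (Unt T), Mul = map_prod (Mul S) (Mul T)\<rparr>"

type_synonym ('o, 'a, 'p, 'b) cell1 = "('o, 'a, 'p, 'b) ftor \<times> ('o \<Rightarrow> 'b)"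

fun one_cell :: "('o, 'a) mnd \<Rightarrow> ('p, 'b) mnd \<Rightarrow> ('o, 'a, 'p, 'b) cell1 \<Rightarrow> bool" where
  "one_cell S T (B, \<psi>) \<longleftrightarrow>
     monad S \<and> monad T \<and> cat_functor (Cat S) (Cat T) B \<and>
     nat_trans (Cat S) (Cat T) (Fun T \<circ>\<^sub>F B) (B \<circ>\<^sub>F Fun S) \<psi> \<and>
     (\<forall>x\<in>Obj (Cat S).
        \<psi> x \<cdot>\<^bsub>Cat T\<^esub> Mul T (FObj B x) =
        FArr B (Mul S x) \<cdot>\<^bsub>Cat T\<^esub> \<psi> (FObj (Fun S) x) \<cdot>\<^bsub>Cat T\<^esub> FArr (Fun T) (\<psi> x)) \<and>
     (\<forall>x\<in>Obj (Cat S). \<psi> x \<cdot>\<^bsub>Cat T\<^esub> Unt T (FObj B x) = FArr B (Unt S x))"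

fun two_cell ::
  "('o, 'a) mnd \<Rightarrow> ('p, 'b) mnd \<Rightarrow> ('o, 'a, 'p, 'b) cell1 \<Rightarrow> ('o, 'a, 'p, 'b) cell1 \<Rightarrow>
   ('o \<Rightarrow> 'b) \<Rightarrow> bool" where
  "two_cell S T (A, \<psi>A) (B, \<psi>B) \<theta> \<longleftrightarrow>
     one_cell S T (A, \<psi>A) \<and> one_cell S T (B, \<psi>B) \<and>
     nat_trans (Cat S) (Cat T) A B \<theta> \<and>
     (\<forall>x\<in>Obj (Cat S).
        \<psi>B x \<cdot>\<^bsub>Cat T\<^esub> FArr (Fun T) (\<theta> x) = \<theta> (FObj (Fun S) x) \<cdot>\<^bsub>Cat T\<^esub> \<psi>A x)"

definition id_cell :: "('o, 'a) mnd \<Rightarrow> ('o, 'a, 'o, 'a) cell1" where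
  "id_cell S = (id_ftor, \<lambda>x. Idn (Cat S) (FObj (Fun S) x))"

text \<open>The first argument of \<^term>\<open>comp_cell\<close> is the codomain of the composite 1-cell.\<close>

fun comp_cell ::
  "('q, 'c) mnd \<Rightarrow> ('p, 'b, 'q, 'c) cell1 \<Rightarrow> ('o, 'a, 'p, 'b) cell1 \<Rightarrow>
   ('o, 'a, 'q, 'c) cell1" where
  "comp_cell R (K, \<psi>K) (J, \<psi>J) =
     (K \<circ>\<^sub>F J, \<lambda>x. FArr K (\<psi>J x) \<cdot>\<^bsub>Cat R\<^esub> \<psi>K (FObj J x))"

definition adjoint_object ::
  "('o, 'a) mnd \<Rightarrow> ('p, 'b) mnd \<Rightarrow> ('o, 'a, 'p, 'b) cell1 \<Rightarrow> ('p, 'b, 'o, 'a) cell1 \<Rightarrow>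
   ('o \<Rightarrow> 'a) \<Rightarrow> ('p \<Rightarrow> 'b) \<Rightarrow> bool" where
  "adjoint_object S T L R \<eta> \<epsilon> \<longleftrightarrow>
     one_cell S T L \<and> one_cell T S R \<and>
     adjunction (Cat S) (Cat T) (fst L) (fst R) \<eta> \<epsilon> \<and>
     two_cell S S (id_cell S) (comp_cell S R L) \<eta> \<and>
     two_cell T T (comp_cell T L R) (id_cell T) \<epsilon>"


section \<open>The Eilenberg--Moore category\<close>

definition EM_algebras :: "('o, 'a) mnd \<Rightarrow> ('o \<times> 'a) set" where
  "EM_algebras E = {(M, k). M \<in> Obj (Cat E) \<and> k \<in> Hom (Cat E) (FObj (Fun E) M) M \<and>
     k \<cdot>\<^bsub>Cat E\<^esub> Unt E M = Idn (Cat E) M \<and>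
     k \<cdot>\<^bsub>Cat E\<^esub> FArr (Fun E) k = k \<cdot>\<^bsub>Cat E\<^esub> Mul E M}"

text \<open>
  An algebra morphism carries its source and target algebras, since the underlying arrow does
  not determine them.
\<close>

definition EM_arrows :: "('o, 'a) mnd \<Rightarrow> (('o \<times> 'a) \<times> 'a \<times> ('o \<times> 'a)) set" where
  "EM_arrows E = {((M, k), f, (N, l)). (M, k) \<in> EM_algebras E \<and> (N, l) \<in> EM_algebras E \<and>
     f \<in> Hom (Cat E) M N \<and> f \<cdot>\<^bsub>Cat E\<^esub> k = l \<cdot>\<^bsub>Cat E\<^esub> FArr (Fun E) f}"

definition EM_cat :: "('o, 'a) mnd \<Rightarrow> ('o \<times> 'a, ('o \<times> 'a) \<times> 'a \<times> ('o \<times> 'a)) cat" where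
  "EM_cat E = \<lparr>Obj = EM_algebras E, Arr = EM_arrows E,
     Dom = (\<lambda>(A, f, B). A), Cod = (\<lambda>(A, f, B). B),
     Idn = (\<lambda>A. (A, Idn (Cat E) (fst A), A)),
     Cmp = (\<lambda>(B', g, C) (A, f, B). (A, g \<cdot>\<^bsub>Cat E\<^esub> f, C))\<rparr>"

definition EM_forget :: "('o \<times> 'a, ('o \<times> 'a) \<times> 'a \<times> ('o \<times> 'a), 'o, 'a) ftor" where
  "EM_forget = \<lparr>FObj = fst, FArr = (\<lambda>(A, f, B). f)\<rparr>"


section \<open>Parametric adjunctions\<close>

definition fix_right ::
  "('p, 'b) cat \<Rightarrow> ('o \<times> 'p, 'a \<times> 'b, 'q, 'c) ftor \<Rightarrow> 'p \<Rightarrow> ('o, 'a, 'q, 'c) ftor" where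
  "fix_right P J p = \<lparr>FObj = (\<lambda>x. FObj J (x, p)), FArr = (\<lambda>f. FArr J (f, Idn P p))\<rparr>"

definition fix_left ::
  "('p, 'b) cat \<Rightarrow> ('p \<times> 'o, 'b \<times> 'a, 'q, 'c) ftor \<Rightarrow> 'p \<Rightarrow> ('o, 'a, 'q, 'c) ftor" where
  "fix_left P K p = \<lparr>FObj = (\<lambda>y. FObj K (p, y)), FArr = (\<lambda>g. FArr K (Idn P p, g))\<rparr>"

definition parametric_adjunction ::
  "('oc, 'ac) cat \<Rightarrow> ('op, 'ap) cat \<Rightarrow> ('od, 'ad) cat \<Rightarrow>
   ('oc \<times> 'op, 'ac \<times> 'ap, 'od, 'ad) ftor \<Rightarrow> ('op \<times> 'od, 'ap \<times> 'ad, 'oc, 'ac) ftor \<Rightarrow>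
   ('op \<Rightarrow> 'oc \<Rightarrow> 'ac) \<Rightarrow> ('op \<Rightarrow> 'od \<Rightarrow> 'ad) \<Rightarrow> bool" where
  "parametric_adjunction C P D J K \<eta> \<epsilon> \<longleftrightarrow>
     cat_functor (prod_cat C P) D J \<and>
     cat_functor (prod_cat (op_cat P) D) C K \<and>
     (\<forall>p\<in>Obj P. adjunction C D (fix_right P J p) (fix_left (op_cat P) K p) (\<eta> p) (\<epsilon> p)) \<and>
     (\<forall>p\<in>Obj P. \<forall>p'\<in>Obj P. \<forall>f\<in>Hom P p p'. \<forall>d\<in>Obj D.
        FArr K (f, Idn D d) =
        FArr (fix_left (op_cat P) K p) (\<epsilon> p' d) \<cdot>\<^bsub>C\<^esub>
        FArr (fix_left (op_cat P) K p) (FArr J (Idn C (FObj K (p', d)), f)) \<cdot>\<^bsub>C\<^esub>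
        \<eta> p (FObj K (p', d)))"


section \<open>Hopf 1-cells and the induced structures\<close>

definition hopf_map ::
  "('oc, 'ac) mnd \<Rightarrow> ('od, 'ad) mnd \<Rightarrow> ('oc \<times> 'op, 'ac \<times> 'ap, 'od, 'ad) cell1 \<Rightarrow>
   'oc \<times> ('op \<times> 'ap) \<Rightarrow> 'ad" where
  "hopf_map S T = (\<lambda>(J, \<psi>J) (c, (M, k)).
     FArr J (Idn (Cat S) (FObj (Fun S) c), k) \<cdot>\<^bsub>Cat T\<^esub> \<psi>J (c, M))"

definition left_hopf ::
  "('oc, 'ac) mnd \<Rightarrow> ('op, 'ap) mnd \<Rightarrow> ('od, 'ad) mnd \<Rightarrow>
   ('oc \<times> 'op, 'ac \<times> 'ap, 'od, 'ad) cell1 \<Rightarrow> bool" where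
  "left_hopf S E T L \<longleftrightarrow>
     one_cell (prod_mnd S E) T L \<and>
     invertible_trans (prod_cat (Cat S) (EM_cat E)) (Cat T)
       (Fun T \<circ>\<^sub>F fst L \<circ>\<^sub>F (id_ftor \<times>\<^sub>F EM_forget))
       (fst L \<circ>\<^sub>F (Fun S \<times>\<^sub>F EM_forget))
       (hopf_map S T L)"

definition psi_J ::
  "('oc, 'ac) mnd \<Rightarrow> ('od, 'ad) mnd \<Rightarrow> ('oc \<times> 'op, 'ac \<times> 'ap, 'od, 'ad) cell1 \<Rightarrow>
   'op \<times> 'ap \<Rightarrow> 'oc \<Rightarrow> 'ad" where
  "psi_J S T L A c = hopf_map S T L (c, A)"

definition psi_K ::
  "('oc, 'ac) mnd \<Rightarrow> ('op, 'ap) mnd \<Rightarrow> ('od, 'ad) mnd \<Rightarrow>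
   ('oc \<times> 'op, 'ac \<times> 'ap, 'od, 'ad) cell1 \<Rightarrow> ('op \<times> 'od, 'ap \<times> 'ad, 'oc, 'ac) ftor \<Rightarrow>
   ('op \<Rightarrow> 'oc \<Rightarrow> 'ac) \<Rightarrow> ('op \<Rightarrow> 'od \<Rightarrow> 'ad) \<Rightarrow> 'op \<times> 'ap \<Rightarrow> 'od \<Rightarrow> 'ac" where
  "psi_K S E T L K \<eta> \<epsilon> A d =
     (let M = fst A; KM = fix_left (op_cat (Cat E)) K M in
        FArr KM (FArr (Fun T) (\<epsilon> M d)) \<cdot>\<^bsub>Cat S\<^esub>
        FArr KM (inv_arrow (Cat T) (psi_J S T L A (FObj KM d))) \<cdot>\<^bsub>Cat S\<^esub>
        \<eta> M (FObj (Fun S) (FObj KM d)))"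

end

theory Submission
  imports Defs
begin

text \<open>
  The Hopf map at an algebra \<open>(M, k)\<close> makes \<open>J\<^sub>M\<close> a left adjoint whose monad transformation has an
  inverse \<open>\<sigma>\<close>. By construction \<open>\<psi>\<^sup>K\<^sup>M\<close> is the mate of \<open>\<sigma>\<close>: its transpose \<open>\<epsilon> \<circ> J\<^sub>M \<psi>\<^sup>K\<^sup>M\<close> is
  \<open>T \<epsilon> \<circ> \<sigma>\<close>. Transposition along \<open>(J\<^sub>M, K\<^sub>M)\<close> is injective, so every equation about \<open>\<psi>\<^sup>K\<^sup>M\<close>
  reduces to one about \<open>\<sigma>\<close>. For naturality in the algebra, the mate formula for \<open>K\<close> on parameter arrows
  gives \<open>\<epsilon>\<^sup>M \<circ> J\<^sub>M (K f) = \<epsilon>\<^sup>N \<circ> J (K\<^sub>N, f)\<close>, and inverting the naturality square of the Hopf map in the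
  algebra does the rest.
\<close>

section \<open>Simplification rules\<close>

lemma ftor_simps [simp]:
  "FObj id_ftor x = x" "FArr id_ftor f = f"
  "FObj (G \<circ>\<^sub>F F) x = FObj G (FObj F x)" "FArr (G \<circ>\<^sub>F F) f = FArr G (FArr F f)"
  "FObj (F1 \<times>\<^sub>F F2) (u, v) = (FObj F1 u, FObj F2 v)"
  "FArr (F1 \<times>\<^sub>F F2) (g, h) = (FArr F1 g, FArr F2 h)"
  "op_ftor F = F"
  by (auto simp: id_ftor_def comp_ftor_def prod_ftor_def op_ftor_def)

lemma prod_cat_simps [simp]:
  "Obj (prod_cat C D) = Obj C \<times> Obj D" "Arr (prod_cat C D) = Arr C \<times> Arr D"
  "Dom (prod_cat C D) (f, g) = (Dom C f, Dom D g)" "Cod (prod_cat C D) (f, g) = (Cod C f, Cod D g)"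
  "Idn (prod_cat C D) (x, y) = (Idn C x, Idn D y)"
  "(f', g') \<cdot>\<^bsub>prod_cat C D\<^esub> (f, g) = (f' \<cdot>\<^bsub>C\<^esub> f, g' \<cdot>\<^bsub>D\<^esub> g)"
  by (auto simp: prod_cat_def)

lemma op_cat_simps [simp]:
  "Obj (op_cat C) = Obj C" "Arr (op_cat C) = Arr C" "Dom (op_cat C) = Cod C"
  "Cod (op_cat C) = Dom C" "Idn (op_cat C) = Idn C" "g \<cdot>\<^bsub>op_cat C\<^esub> f = f \<cdot>\<^bsub>C\<^esub> g"
  by (auto simp: op_cat_def)

lemma mnd_simps [simp]:
  "Cat (id_mnd C) = C" "Fun (id_mnd C) = id_ftor" "Unt (id_mnd C) = Idn C" "Mul (id_mnd C) = Idn C"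
  "Cat (prod_mnd S T) = prod_cat (Cat S) (Cat T)" "Fun (prod_mnd S T) = Fun S \<times>\<^sub>F Fun T"
  "Unt (prod_mnd S T) (x, y) = (Unt S x, Unt T y)" "Mul (prod_mnd S T) (x, y) = (Mul S x, Mul T y)"
  by (auto simp: id_mnd_def prod_mnd_def)

lemma fix_simps [simp]:
  "FObj (fix_right P J p) x = FObj J (x, p)" "FArr (fix_right P J p) f = FArr J (f, Idn P p)"
  "FObj (fix_left P K p) y = FObj K (p, y)" "FArr (fix_left P K p) g = FArr K (Idn P p, g)"
  by (auto simp: fix_right_def fix_left_def)

lemma EM_simps [simp]:
  "Obj (EM_cat E) = EM_algebras E" "Arr (EM_cat E) = EM_arrows E"
  "Dom (EM_cat E) (A, f, B) = A" "Cod (EM_cat E) (A, f, B) = B"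
  "Idn (EM_cat E) A = (A, Idn (Cat E) (fst A), A)"
  "(B', g, D) \<cdot>\<^bsub>EM_cat E\<^esub> (A, f, B) = (A, g \<cdot>\<^bsub>Cat E\<^esub> f, D)"
  "FObj EM_forget A = fst A" "FArr EM_forget (A, f, B) = f"
  by (auto simp: EM_cat_def EM_forget_def)

text \<open>
  With typing expressed through \<^const>\<open>Dom\<close> and \<^const>\<open>Cod\<close> instead of \<^const>\<open>Hom\<close>, the side
  conditions contain no schematic objects and the simplifier can discharge them.
\<close>

lemma (in category) Cmp_simps [simp]:
  "f \<in> Arr C \<Longrightarrow> Dom C f \<in> Obj C"
  "f \<in> Arr C \<Longrightarrow> Cod C f \<in> Obj C"
  "x \<in> Obj C \<Longrightarrow> Idn C x \<in> Arr C"
  "x \<in> Obj C \<Longrightarrow> Dom C (Idn C x) = x"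
  "x \<in> Obj C \<Longrightarrow> Cod C (Idn C x) = x"
  "f \<in> Arr C \<Longrightarrow> g \<in> Arr C \<Longrightarrow> Dom C g = Cod C f \<Longrightarrow> g \<cdot>\<^bsub>C\<^esub> f \<in> Arr C"
  "f \<in> Arr C \<Longrightarrow> g \<in> Arr C \<Longrightarrow> Dom C g = Cod C f \<Longrightarrow> Dom C (g \<cdot>\<^bsub>C\<^esub> f) = Dom C f"
  "f \<in> Arr C \<Longrightarrow> g \<in> Arr C \<Longrightarrow> Dom C g = Cod C f \<Longrightarrow> Cod C (g \<cdot>\<^bsub>C\<^esub> f) = Cod C g"
  "f \<in> Arr C \<Longrightarrow> Cod C f = x \<Longrightarrow> Idn C x \<cdot>\<^bsub>C\<^esub> f = f"
  "f \<in> Arr C \<Longrightarrow> Dom C f = x \<Longrightarrow> f \<cdot>\<^bsub>C\<^esub> Idn C x = f"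
  "f \<in> Arr C \<Longrightarrow> g \<in> Arr C \<Longrightarrow> h \<in> Arr C \<Longrightarrow> Dom C g = Cod C f \<Longrightarrow> Dom C h = Cod C g \<Longrightarrow>
     (h \<cdot>\<^bsub>C\<^esub> g) \<cdot>\<^bsub>C\<^esub> f = h \<cdot>\<^bsub>C\<^esub> g \<cdot>\<^bsub>C\<^esub> f"
  using Dom_closed Cod_closed Idn_Hom Cmp_Hom Idn_left Idn_right Cmp_assoc
  by (auto simp: Hom_def)

text \<open>Composites are normalised to the right, so the left side of an equation between two
  adjacent arrows does not occur literally in a longer composite. Instantiated with
  \<open>OF\<close>, this turns such an equation into a rewrite rule with a tail \<open>e\<close>;
  the diagram chases below are sequences of these rules.\<close>

lemma (in category) Cmp_reassoc:
  assumes "g \<cdot>\<^bsub>C\<^esub> f = r" "f \<in> Arr C" "g \<in> Arr C" "Dom C g = Cod C f" "e \<in> Arr C" "Cod C e = Dom C f"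
  shows "g \<cdot>\<^bsub>C\<^esub> f \<cdot>\<^bsub>C\<^esub> e = r \<cdot>\<^bsub>C\<^esub> e"
  using assms by (metis Cmp_simps(11))

text \<open>Goals phrased with \<open>Dom\<close> and \<open>Cod\<close> have the form that the simp
  rules handle. \<open>cat_functor_intro\<close> and \<open>nat_trans_intro\<close> serve the same
  purpose.\<close>

lemma category_intro:
  assumes "\<And>f. f \<in> Arr C \<Longrightarrow> Dom C f \<in> Obj C \<and> Cod C f \<in> Obj C"
    and "\<And>x. x \<in> Obj C \<Longrightarrow> Idn C x \<in> Arr C \<and> Dom C (Idn C x) = x \<and> Cod C (Idn C x) = x"
    and "\<And>f g. f \<in> Arr C \<Longrightarrow> g \<in> Arr C \<Longrightarrow> Dom C g = Cod C f \<Longrightarrow>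
      g \<cdot>\<^bsub>C\<^esub> f \<in> Arr C \<and> Dom C (g \<cdot>\<^bsub>C\<^esub> f) = Dom C f \<and> Cod C (g \<cdot>\<^bsub>C\<^esub> f) = Cod C g"
    and "\<And>f. f \<in> Arr C \<Longrightarrow> Idn C (Cod C f) \<cdot>\<^bsub>C\<^esub> f = f \<and> f \<cdot>\<^bsub>C\<^esub> Idn C (Dom C f) = f"
    and "\<And>f g h. f \<in> Arr C \<Longrightarrow> g \<in> Arr C \<Longrightarrow> h \<in> Arr C \<Longrightarrow> Dom C g = Cod C f \<Longrightarrow>
      Dom C h = Cod C g \<Longrightarrow> (h \<cdot>\<^bsub>C\<^esub> g) \<cdot>\<^bsub>C\<^esub> f = h \<cdot>\<^bsub>C\<^esub> g \<cdot>\<^bsub>C\<^esub> f"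
  shows "category C"
  using assms by unfold_locales (auto simp: Hom_def)

lemma (in cat_functor) FArr_simps [simp]:
  "x \<in> Obj C \<Longrightarrow> FObj F x \<in> Obj D"
  "f \<in> Arr C \<Longrightarrow> FArr F f \<in> Arr D"
  "f \<in> Arr C \<Longrightarrow> Dom D (FArr F f) = FObj F (Dom C f)"
  "f \<in> Arr C \<Longrightarrow> Cod D (FArr F f) = FObj F (Cod C f)"
  "x \<in> Obj C \<Longrightarrow> FArr F (Idn C x) = Idn D (FObj F x)"
  "f \<in> Arr C \<Longrightarrow> g \<in> Arr C \<Longrightarrow> Dom C g = Cod C f \<Longrightarrow>
     FArr F (g \<cdot>\<^bsub>C\<^esub> f) = FArr F g \<cdot>\<^bsub>D\<^esub> FArr F f"
  using FObj_closed FArr_Hom FArr_Idn FArr_Cmp by (auto simp: Hom_def)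

lemma cat_functor_intro:
  assumes "category C" "category D" "\<And>x. x \<in> Obj C \<Longrightarrow> FObj F x \<in> Obj D"
    and "\<And>f. f \<in> Arr C \<Longrightarrow> FArr F f \<in> Arr D \<and> Dom D (FArr F f) = FObj F (Dom C f) \<and>
      Cod D (FArr F f) = FObj F (Cod C f)"
    and "\<And>x. x \<in> Obj C \<Longrightarrow> FArr F (Idn C x) = Idn D (FObj F x)"
    and "\<And>f g. f \<in> Arr C \<Longrightarrow> g \<in> Arr C \<Longrightarrow> Dom C g = Cod C f \<Longrightarrow>
      FArr F (g \<cdot>\<^bsub>C\<^esub> f) = FArr F g \<cdot>\<^bsub>D\<^esub> FArr F f"
  shows "cat_functor C D F"
  using assms by (auto simp: cat_functor_def cat_functor_axioms_def Hom_def)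

lemma (in nat_trans) component_simps [simp]:
  "x \<in> Obj C \<Longrightarrow> \<tau> x \<in> Arr D"
  "x \<in> Obj C \<Longrightarrow> Dom D (\<tau> x) = FObj F x"
  "x \<in> Obj C \<Longrightarrow> Cod D (\<tau> x) = FObj G x"
  using component_Hom by (auto simp: Hom_def)

lemma (in nat_trans) naturality_Arr:
  "f \<in> Arr C \<Longrightarrow> \<tau> (Cod C f) \<cdot>\<^bsub>D\<^esub> FArr F f = FArr G f \<cdot>\<^bsub>D\<^esub> \<tau> (Dom C f)"
  using naturality by (auto simp: Hom_def)

lemma nat_trans_intro:
  assumes "cat_functor C D F" "cat_functor C D G"
    and "\<And>x. x \<in> Obj C \<Longrightarrow> \<tau> x \<in> Arr D \<and> Dom D (\<tau> x) = FObj F x \<and> Cod D (\<tau> x) = FObj G x"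
    and "\<And>f. f \<in> Arr C \<Longrightarrow> \<tau> (Cod C f) \<cdot>\<^bsub>D\<^esub> FArr F f = FArr G f \<cdot>\<^bsub>D\<^esub> \<tau> (Dom C f)"
  shows "nat_trans C D F G \<tau>"
  using assms by (auto simp: nat_trans_def nat_trans_axioms_def Hom_def)

section \<open>Constructions\<close>

lemma category_prod: "category C \<Longrightarrow> category D \<Longrightarrow> category (prod_cat C D)"
proof -
  assume "category C" "category D"
  then interpret C: category C + D: category D .
  show ?thesis by (rule category_intro) auto
qed

lemma category_op: "category C \<Longrightarrow> category (op_cat C)"
proof -
  assume "category C"
  then interpret C: category C .
  show ?thesis by (rule category_intro) auto
qed

lemma functor_id: "category C \<Longrightarrow> cat_functor C C id_ftor"
  by (rule cat_functor_intro) auto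

lemma functor_comp:
  assumes "cat_functor B C F" "cat_functor C D G"
  shows "cat_functor B D (G \<circ>\<^sub>F F)"
proof -
  interpret F: cat_functor B C F by fact
  interpret G: cat_functor C D G by fact
  show ?thesis by (rule cat_functor_intro) (auto intro: F.dom.category_axioms G.cod.category_axioms)
qed

lemma functor_prod:
  assumes "cat_functor C D F" "cat_functor C' D' G"
  shows "cat_functor (prod_cat C C') (prod_cat D D') (F \<times>\<^sub>F G)"
proof -
  interpret F: cat_functor C D F by fact
  interpret G: cat_functor C' D' G by fact
  show ?thesis
    by (rule cat_functor_intro)
      (auto intro: category_prod F.dom.category_axioms G.dom.category_axioms
         F.cod.category_axioms G.cod.category_axioms)
qed

lemma functor_op: "cat_functor C D F \<Longrightarrow> cat_functor (op_cat C) (op_cat D) F"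
proof -
  assume "cat_functor C D F"
  then interpret F: cat_functor C D F .
  show ?thesis
    by (rule cat_functor_intro)
      (auto intro: category_op F.dom.category_axioms F.cod.category_axioms)
qed

section \<open>Identity and product monads\<close>

context monad
begin

sublocale category "Cat S" by (rule Cat_category)
sublocale Fun: cat_functor "Cat S" "Cat S" "Fun S" by (rule Fun_functor)
sublocale Unt: nat_trans "Cat S" "Cat S" id_ftor "Fun S" "Unt S" by (rule Unt_nat)
sublocale Mul: nat_trans "Cat S" "Cat S" "Fun S \<circ>\<^sub>F Fun S" "Fun S" "Mul S" by (rule Mul_nat)

end

lemma monad_id: "category C \<Longrightarrow> monad (id_mnd C)"
proof -
  assume C: "category C"
  then interpret C: category C .
  have N: "nat_trans C C id_ftor id_ftor (Idn C)"
    by (rule nat_trans_intro) (auto intro: functor_id C)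
  \<comment> \<open>The multiplication starts at the composite of \<open>id_ftor\<close> with
    itself. This composite equals \<open>id_ftor\<close> as a record, so \<open>N\<close> serves for
    both unit and multiplication.\<close>
  have "id_ftor \<circ>\<^sub>F id_ftor = (id_ftor :: ('a, 'b, 'a, 'b) ftor)"
    by (simp add: id_ftor_def comp_ftor_def)
  with N C show ?thesis
    by (auto simp: monad_def functor_id)
qed

lemma monad_prod:
  assumes "monad S" "monad T"
  shows "monad (prod_mnd S T)"
proof -
  interpret S: monad S by fact
  interpret T: monad T by fact
  have C: "category (prod_cat (Cat S) (Cat T))"
    by (intro category_prod S.Cat_category T.Cat_category)
  have F: "cat_functor (prod_cat (Cat S) (Cat T)) (prod_cat (Cat S) (Cat T)) (Fun S \<times>\<^sub>F Fun T)"
    by (intro functor_prod S.Fun_functor T.Fun_functor)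
  show ?thesis
  proof (rule monad.intro)
    show "nat_trans (Cat (prod_mnd S T)) (Cat (prod_mnd S T)) id_ftor (Fun (prod_mnd S T))
        (Unt (prod_mnd S T))"
      using S.Unt.naturality_Arr T.Unt.naturality_Arr
      by (intro nat_trans_intro) (auto simp: F functor_id C)
    show "nat_trans (Cat (prod_mnd S T)) (Cat (prod_mnd S T))
        (Fun (prod_mnd S T) \<circ>\<^sub>F Fun (prod_mnd S T)) (Fun (prod_mnd S T)) (Mul (prod_mnd S T))"
      using S.Mul.naturality_Arr T.Mul.naturality_Arr
      by (intro nat_trans_intro) (auto simp: F functor_comp[OF F F])
  qed (auto simp: C F S.Mul_assoc T.Mul_assoc S.Unt_left T.Unt_left S.Unt_right T.Unt_right)
qed

section \<open>The Eilenberg-Moore category and its forgetful functor\<close>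

context monad
begin

lemma EM_algebraD:
  assumes "(M, k) \<in> EM_algebras S"
  shows "M \<in> Obj (Cat S)" "k \<in> Arr (Cat S)" "Dom (Cat S) k = FObj (Fun S) M" "Cod (Cat S) k = M"
    "k \<cdot>\<^bsub>Cat S\<^esub> Unt S M = Idn (Cat S) M"
    "k \<cdot>\<^bsub>Cat S\<^esub> FArr (Fun S) k = k \<cdot>\<^bsub>Cat S\<^esub> Mul S M"
  using assms by (auto simp: EM_algebras_def Hom_def)

lemma EM_arrow_iff:
  "((M, k), f, (N, l)) \<in> EM_arrows S \<longleftrightarrow> (M, k) \<in> EM_algebras S \<and> (N, l) \<in> EM_algebras S \<and>
    f \<in> Arr (Cat S) \<and> Dom (Cat S) f = M \<and> Cod (Cat S) f = N \<and>
    f \<cdot>\<^bsub>Cat S\<^esub> k = l \<cdot>\<^bsub>Cat S\<^esub> FArr (Fun S) f"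
  by (auto simp: EM_arrows_def Hom_def)

text \<open>The axiom with content is closure under composition: the squares of two algebra
  morphisms are pasted. The remaining laws are inherited from the base category.\<close>

lemma category_EM: "category (EM_cat S)"
proof (rule category_intro)
  fix f g assume f: "f \<in> Arr (EM_cat S)" and g: "g \<in> Arr (EM_cat S)"
    and eq: "Dom (EM_cat S) g = Cod (EM_cat S) f"
  obtain M k f' N l where f': "f = ((M, k), f', (N, l))" by (metis surj_pair)
  obtain g' N' l' R m where g': "g = ((N', l'), g', (R, m))" by (metis surj_pair)
  \<comment> \<open>Arrows carry their algebras, so composability identifies the structure maps
    \<open>l\<close> and \<open>l'\<close> along with the carriers.\<close>
  have [simp]: "N' = N" "l' = l" using eq by (auto simp: f' g')
  note F = f[unfolded f', simplified, unfolded EM_arrow_iff]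
  note G = g[unfolded g', simplified, unfolded EM_arrow_iff]
  have A: "(M, k) \<in> EM_algebras S" "(N, l) \<in> EM_algebras S" "(R, m) \<in> EM_algebras S"
    using F G by auto
  note [simp] = EM_algebraD(1-4)[OF A(1)] EM_algebraD(1-4)[OF A(2)] EM_algebraD(1-4)[OF A(3)]
  have [simp]: "f' \<in> Arr (Cat S)" "Dom (Cat S) f' = M" "Cod (Cat S) f' = N"
    "g' \<in> Arr (Cat S)" "Dom (Cat S) g' = N" "Cod (Cat S) g' = R"
    and e: "f' \<cdot>\<^bsub>Cat S\<^esub> k = l \<cdot>\<^bsub>Cat S\<^esub> FArr (Fun S) f'" "g' \<cdot>\<^bsub>Cat S\<^esub> l = m \<cdot>\<^bsub>Cat S\<^esub> FArr (Fun S) g'"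
    using F G by auto
  have "(g' \<cdot>\<^bsub>Cat S\<^esub> f') \<cdot>\<^bsub>Cat S\<^esub> k = m \<cdot>\<^bsub>Cat S\<^esub> FArr (Fun S) (g' \<cdot>\<^bsub>Cat S\<^esub> f')"
    by (simp add: e(1) Cmp_reassoc[OF e(2)])
  then show "g \<cdot>\<^bsub>EM_cat S\<^esub> f \<in> Arr (EM_cat S) \<and>
      Dom (EM_cat S) (g \<cdot>\<^bsub>EM_cat S\<^esub> f) = Dom (EM_cat S) f \<and>
      Cod (EM_cat S) (g \<cdot>\<^bsub>EM_cat S\<^esub> f) = Cod (EM_cat S) g"
    using A by (simp add: f' g' EM_arrow_iff)
qed (auto simp: EM_arrow_iff EM_algebraD)

lemma functor_EM_forget: "cat_functor (EM_cat S) (Cat S) EM_forget"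
  by (rule cat_functor_intro) (auto simp: category_EM Cat_category EM_arrow_iff EM_algebraD)

end

section \<open>Morphisms of monads\<close>

text \<open>The locale form of \<open>one_cell\<close> makes the typing rules of its functor and
  transformation available by interpretation.\<close>

locale monad_morphism =
  S: monad S + T: monad T + B: cat_functor "Cat S" "Cat T" B +
  \<psi>: nat_trans "Cat S" "Cat T" "Fun T \<circ>\<^sub>F B" "B \<circ>\<^sub>F Fun S" \<psi>
  for S :: "('o, 'a) mnd" and T :: "('p, 'b) mnd" and B \<psi> +
  assumes mult: "x \<in> Obj (Cat S) \<Longrightarrow> \<psi> x \<cdot>\<^bsub>Cat T\<^esub> Mul T (FObj B x) =
        FArr B (Mul S x) \<cdot>\<^bsub>Cat T\<^esub> \<psi> (FObj (Fun S) x) \<cdot>\<^bsub>Cat T\<^esub> FArr (Fun T) (\<psi> x)"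
    and unit: "x \<in> Obj (Cat S) \<Longrightarrow> \<psi> x \<cdot>\<^bsub>Cat T\<^esub> Unt T (FObj B x) = FArr B (Unt S x)"

lemma one_cell_iff: "one_cell S T (B, \<psi>) \<longleftrightarrow> monad_morphism S T B \<psi>"
  by (auto simp: monad_morphism_def monad_morphism_axioms_def)

lemma one_cell_id:
  assumes "monad S"
  shows "one_cell S S (id_cell S)"
proof -
  interpret monad S by fact
  show ?thesis
    by (auto simp: id_cell_def assms functor_id Cat_category
        intro!: nat_trans_intro functor_comp[OF Fun_functor functor_id]
          functor_comp[OF functor_id Fun_functor])
qed

text \<open>The squares of the two cells are pasted. In the multiplication law, the law of
  \<open>\<phi>\<close> is applied at \<open>FObj J x\<close>, that of \<open>\<psi>\<close> under
  \<open>K\<close>, and naturality of \<open>\<phi>\<close> at the arrow \<open>\<psi> x\<close>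
  interchanges the two.\<close>

lemma one_cell_comp:
  assumes "one_cell S T (J, \<psi>)" "one_cell T R (K, \<phi>)"
  shows "one_cell S R (comp_cell R (K, \<phi>) (J, \<psi>))"
proof -
  interpret J: monad_morphism S T J \<psi> using assms by (simp only: one_cell_iff)
  interpret K: monad_morphism T R K \<phi> using assms by (simp only: one_cell_iff)
  have J: "cat_functor (Cat S) (Cat T) J" and K: "cat_functor (Cat T) (Cat R) K" ..
  have S: "cat_functor (Cat S) (Cat S) (Fun S)" and R: "cat_functor (Cat R) (Cat R) (Fun R)" ..
  let ?\<chi> = "\<lambda>x. FArr K (\<psi> x) \<cdot>\<^bsub>Cat R\<^esub> \<phi> (FObj J x)"
  have "nat_trans (Cat S) (Cat R) (Fun R \<circ>\<^sub>F K \<circ>\<^sub>F J) ((K \<circ>\<^sub>F J) \<circ>\<^sub>F Fun S) ?\<chi>"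
  proof (rule nat_trans_intro)
    fix f assume [simp]: "f \<in> Arr (Cat S)"
    have 1: "\<phi> (FObj J (Cod (Cat S) f)) \<cdot>\<^bsub>Cat R\<^esub> FArr (Fun R) (FArr K (FArr J f)) =
        FArr K (FArr (Fun T) (FArr J f)) \<cdot>\<^bsub>Cat R\<^esub> \<phi> (FObj J (Dom (Cat S) f))"
      using K.\<psi>.naturality_Arr[of "FArr J f"] by simp
    have 2: "FArr K (\<psi> (Cod (Cat S) f)) \<cdot>\<^bsub>Cat R\<^esub> FArr K (FArr (Fun T) (FArr J f)) =
        FArr K (FArr J (FArr (Fun S) f)) \<cdot>\<^bsub>Cat R\<^esub> FArr K (\<psi> (Dom (Cat S) f))"
      using arg_cong[OF J.\<psi>.naturality_Arr[of f], of "FArr K"] by simp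
    show "?\<chi> (Cod (Cat S) f) \<cdot>\<^bsub>Cat R\<^esub> FArr (Fun R \<circ>\<^sub>F K \<circ>\<^sub>F J) f =
        FArr ((K \<circ>\<^sub>F J) \<circ>\<^sub>F Fun S) f \<cdot>\<^bsub>Cat R\<^esub> ?\<chi> (Dom (Cat S) f)"
      by (simp add: 1 K.T.Cmp_reassoc[OF 2])
  qed (auto intro: functor_comp J K S R)
  moreover have "?\<chi> x \<cdot>\<^bsub>Cat R\<^esub> Mul R (FObj (K \<circ>\<^sub>F J) x) =
      FArr (K \<circ>\<^sub>F J) (Mul S x) \<cdot>\<^bsub>Cat R\<^esub> ?\<chi> (FObj (Fun S) x) \<cdot>\<^bsub>Cat R\<^esub> FArr (Fun R) (?\<chi> x)"
    if [simp]: "x \<in> Obj (Cat S)" for x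
  proof -
    have 1: "FArr K (\<psi> x) \<cdot>\<^bsub>Cat R\<^esub> FArr K (Mul T (FObj J x)) =
      FArr K (FArr J (Mul S x)) \<cdot>\<^bsub>Cat R\<^esub> FArr K (\<psi> (FObj (Fun S) x)) \<cdot>\<^bsub>Cat R\<^esub>
      FArr K (FArr (Fun T) (\<psi> x))"
      using arg_cong[OF J.mult[of x], of "FArr K"] by simp
    have 2: "\<phi> (FObj J (FObj (Fun S) x)) \<cdot>\<^bsub>Cat R\<^esub> FArr (Fun R) (FArr K (\<psi> x)) =
      FArr K (FArr (Fun T) (\<psi> x)) \<cdot>\<^bsub>Cat R\<^esub> \<phi> (FObj (Fun T) (FObj J x))"
      using K.\<psi>.naturality_Arr[of "\<psi> x"] by simp
    show ?thesis
      by (simp add: K.mult K.T.Cmp_reassoc[OF 1] K.T.Cmp_reassoc[OF 2])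
  qed
  moreover have "?\<chi> x \<cdot>\<^bsub>Cat R\<^esub> Unt R (FObj (K \<circ>\<^sub>F J) x) = FArr (K \<circ>\<^sub>F J) (Unt S x)"
    if [simp]: "x \<in> Obj (Cat S)" for x
    using arg_cong[OF J.unit[of x], of "FArr K"] by (simp add: K.unit)
  ultimately show ?thesis
    using assms by (auto simp: functor_comp)
qed


section \<open>Doctrinal adjunction\<close>

text \<open>Insert \<open>f \<cdot> g\<close> to the right of \<open>b\<close>, replace
  \<open>b \<cdot> f\<close> by \<open>f' \<cdot> a\<close>, and cancel
  \<open>g' \<cdot> f'\<close>. Every property of inverses of the Hopf map that comes from a
  naturality square is obtained this way.\<close>

lemma (in category) inverse_arrows_square:
  assumes "inverse_arrows C f g" "inverse_arrows C f' g'"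
    and "a \<in> Hom C (Dom C f) (Dom C f')" "b \<in> Hom C (Cod C f) (Cod C f')"
    and "f' \<cdot>\<^bsub>C\<^esub> a = b \<cdot>\<^bsub>C\<^esub> f"
  shows "g' \<cdot>\<^bsub>C\<^esub> b = a \<cdot>\<^bsub>C\<^esub> g"
proof -
  note [simp] = assms(1-4)[unfolded inverse_arrows_def Hom_def, simplified]
  have g': "g' \<cdot>\<^bsub>C\<^esub> f' = Idn C (Dom C f')" by simp
  have "g' \<cdot>\<^bsub>C\<^esub> b = g' \<cdot>\<^bsub>C\<^esub> (b \<cdot>\<^bsub>C\<^esub> f) \<cdot>\<^bsub>C\<^esub> g" by simp
  also have "\<dots> = g' \<cdot>\<^bsub>C\<^esub> (f' \<cdot>\<^bsub>C\<^esub> a) \<cdot>\<^bsub>C\<^esub> g" by (simp only: assms(5))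
  also have "\<dots> = a \<cdot>\<^bsub>C\<^esub> g" by (simp add: Cmp_reassoc[OF g'])
  finally show ?thesis .
qed

lemma (in category) inv_arrow_eqI:
  assumes "inverse_arrows C f g"
  shows "inv_arrow C f = g"
  unfolding inv_arrow_def
proof (rule the_equality)
  fix g' assume g': "inverse_arrows C f g'"
  \<comment> \<open>Uniqueness of inverses is the case of the square where \<open>f'\<close> is
    \<open>f\<close> and both other sides are identities.\<close>
  have "g' \<cdot>\<^bsub>C\<^esub> Idn C (Cod C f) = Idn C (Dom C f) \<cdot>\<^bsub>C\<^esub> g"
    using assms g' by (intro inverse_arrows_square[OF assms g'])
      (auto simp: inverse_arrows_def Idn_Hom)
  then show "g' = g" using assms g' by (simp add: inverse_arrows_def Hom_def)
qed fact

section \<open>Transposition along an adjunction\<close>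

locale adjoint_pair =
  F: cat_functor C D F + G: cat_functor D C G +
  \<eta>: nat_trans C C id_ftor "G \<circ>\<^sub>F F" \<eta> + \<epsilon>: nat_trans D D "F \<circ>\<^sub>F G" id_ftor \<epsilon>
  for C :: "('o, 'a) cat" and D :: "('p, 'b) cat" and F G \<eta> \<epsilon> +
  assumes triangle_left: "x \<in> Obj C \<Longrightarrow> \<epsilon> (FObj F x) \<cdot>\<^bsub>D\<^esub> FArr F (\<eta> x) = Idn D (FObj F x)"
    and triangle_right: "y \<in> Obj D \<Longrightarrow> FArr G (\<epsilon> y) \<cdot>\<^bsub>C\<^esub> \<eta> (FObj G y) = Idn C (FObj G y)"
begin

lemma counit_nat:
  "g \<in> Arr D \<Longrightarrow> \<epsilon> (Cod D g) \<cdot>\<^bsub>D\<^esub> FArr F (FArr G g) = g \<cdot>\<^bsub>D\<^esub> \<epsilon> (Dom D g)"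
  using \<epsilon>.naturality_Arr by simp

text \<open>Naturality of the counit at \<open>u\<close> moves it past
  \<open>FArr F (FArr G u)\<close>; the left triangle identity at \<open>c\<close> removes what
  remains.\<close>

lemma transpose_inverse:
  assumes [simp]: "u \<in> Arr D" "Dom D u = FObj F c" "c \<in> Obj C"
  shows "\<epsilon> (Cod D u) \<cdot>\<^bsub>D\<^esub> FArr F (FArr G u \<cdot>\<^bsub>C\<^esub> \<eta> c) = u"
  by (simp add: F.cod.Cmp_reassoc[OF counit_nat] triangle_left)

text \<open>An arrow \<open>w\<close> into \<open>FObj G d\<close> is recovered from its transpose
  by applying \<open>G\<close> and precomposing with the unit, by naturality of
  \<open>\<eta>\<close> and the right triangle identity. Equations between arrows into
  \<open>FObj G d\<close> can therefore be checked after transposing.\<close>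

lemma transpose_cancel:
  assumes u: "u \<in> Arr C" "Cod C u = FObj G d" and v: "v \<in> Arr C" "Cod C v = FObj G d"
    and dom: "Dom C u = Dom C v" and d: "d \<in> Obj D"
    and eq: "\<epsilon> d \<cdot>\<^bsub>D\<^esub> FArr F u = \<epsilon> d \<cdot>\<^bsub>D\<^esub> FArr F v"
  shows "u = v"
proof -
  have "FArr G (\<epsilon> d \<cdot>\<^bsub>D\<^esub> FArr F w) \<cdot>\<^bsub>C\<^esub> \<eta> (Dom C w) = w"
    if [simp]: "w \<in> Arr C" "Cod C w = FObj G d" for w
  proof -
    have "FArr G (FArr F w) \<cdot>\<^bsub>C\<^esub> \<eta> (Dom C w) = \<eta> (FObj G d) \<cdot>\<^bsub>C\<^esub> w"
      using \<eta>.naturality_Arr[of w] by simp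
    then show ?thesis
      by (simp add: d F.dom.Cmp_reassoc[OF triangle_right])
  qed
  then show ?thesis using u v dom eq by metis
qed

end

lemma adjunction_iff: "adjunction C D F G \<eta> \<epsilon> \<longleftrightarrow> adjoint_pair C D F G \<eta> \<epsilon>"
  by (auto simp: adjunction_def adjoint_pair_def adjoint_pair_axioms_def)

section \<open>Mates of invertible monad morphisms\<close>

locale strong_left_adjoint =
  monad_morphism S T F \<theta> + adjoint_pair "Cat S" "Cat T" F G \<eta> \<epsilon>
  for S :: "('o, 'a) mnd" and T :: "('p, 'b) mnd" and F \<theta> G \<eta> \<epsilon> +
  assumes invertible: "x \<in> Obj (Cat S) \<Longrightarrow> \<exists>g. inverse_arrows (Cat T) (\<theta> x) g"
begin

abbreviation \<sigma> where "\<sigma> x \<equiv> inv_arrow (Cat T) (\<theta> x)"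

text \<open>The bracketing follows \<open>psi_K\<close>, with \<open>G\<close> applied to each
  factor separately, so that \<open>mate_fibre\<close> holds by unfolding.\<close>

definition mate :: "'p \<Rightarrow> 'a" where
  "mate d = FArr G (FArr (Fun T) (\<epsilon> d)) \<cdot>\<^bsub>Cat S\<^esub> FArr G (\<sigma> (FObj G d)) \<cdot>\<^bsub>Cat S\<^esub>
     \<eta> (FObj (Fun S) (FObj G d))"

text \<open>\<open>\<sigma>\<close> is a definite description; the assumed existence of an inverse,
  with its uniqueness, makes it a genuine one.\<close>

lemma inverse: "x \<in> Obj (Cat S) \<Longrightarrow> inverse_arrows (Cat T) (\<theta> x) (\<sigma> x)"
  using invertible T.inv_arrow_eqI by metis

lemma \<sigma>_simps [simp]:
  assumes "x \<in> Obj (Cat S)"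
  shows "\<sigma> x \<in> Arr (Cat T)" "Dom (Cat T) (\<sigma> x) = FObj F (FObj (Fun S) x)"
    "Cod (Cat T) (\<sigma> x) = FObj (Fun T) (FObj F x)"
    "\<sigma> x \<cdot>\<^bsub>Cat T\<^esub> \<theta> x = Idn (Cat T) (FObj (Fun T) (FObj F x))"
    "\<theta> x \<cdot>\<^bsub>Cat T\<^esub> \<sigma> x = Idn (Cat T) (FObj F (FObj (Fun S) x))"
  using inverse[OF assms] assms by (auto simp: inverse_arrows_def Hom_def)

text \<open>Invertibility is assumed only componentwise. Inverting two opposite sides of the
  naturality square of \<open>\<theta>\<close> supplies naturality of the inverses.\<close>

lemma \<sigma>_nat:
  assumes [simp]: "f \<in> Arr (Cat S)"
  shows "\<sigma> (Cod (Cat S) f) \<cdot>\<^bsub>Cat T\<^esub> FArr F (FArr (Fun S) f) =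
    FArr (Fun T) (FArr F f) \<cdot>\<^bsub>Cat T\<^esub> \<sigma> (Dom (Cat S) f)"
  by (rule T.inverse_arrows_square[OF inverse inverse])
    (use \<psi>.naturality_Arr[of f] in \<open>auto simp: Hom_def\<close>)

text \<open>Insert \<open>\<sigma> x \<cdot> \<theta> x\<close> in front of the right side and apply
  the multiplication law of \<open>\<theta>\<close>; the remaining copies of \<open>\<theta>\<close>
  and \<open>\<sigma>\<close> then cancel in pairs.\<close>

lemma \<sigma>_mult:
  assumes [simp]: "x \<in> Obj (Cat S)"
  shows "\<sigma> x \<cdot>\<^bsub>Cat T\<^esub> FArr F (Mul S x) = Mul T (FObj F x) \<cdot>\<^bsub>Cat T\<^esub> FArr (Fun T) (\<sigma> x) \<cdot>\<^bsub>Cat T\<^esub>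
    \<sigma> (FObj (Fun S) x)"
proof -
  let ?S = "FObj (Fun S) x"
  \<comment> \<open>The functor rule is used from right to left, so that \<open>\<theta> x\<close>
    and \<open>\<sigma> x\<close> meet under \<open>FArr (Fun T)\<close> and cancel.\<close>
  have T\<sigma>: "FArr (Fun T) (\<theta> x) \<cdot>\<^bsub>Cat T\<^esub> FArr (Fun T) (\<sigma> x) =
      Idn (Cat T) (FObj (Fun T) (FObj F ?S))"
    by (simp add: T.Fun.FArr_simps(6)[symmetric] del: T.Fun.FArr_simps(6))
  have "Mul T (FObj F x) \<cdot>\<^bsub>Cat T\<^esub> FArr (Fun T) (\<sigma> x) \<cdot>\<^bsub>Cat T\<^esub> \<sigma> ?S =
      \<sigma> x \<cdot>\<^bsub>Cat T\<^esub> \<theta> x \<cdot>\<^bsub>Cat T\<^esub> Mul T (FObj F x) \<cdot>\<^bsub>Cat T\<^esub> FArr (Fun T) (\<sigma> x) \<cdot>\<^bsub>Cat T\<^esub> \<sigma> ?S"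
    by (simp add: T.Cmp_reassoc[OF \<sigma>_simps(4)])
  also have "\<dots> = \<sigma> x \<cdot>\<^bsub>Cat T\<^esub> FArr F (Mul S x)"
    by (simp add: T.Cmp_reassoc[OF mult] T.Cmp_reassoc[OF T\<sigma>])
  finally show ?thesis ..
qed

lemma mate_simps [simp]:
  assumes "d \<in> Obj (Cat T)"
  shows "mate d \<in> Arr (Cat S)" "Dom (Cat S) (mate d) = FObj (Fun S) (FObj G d)"
    "Cod (Cat S) (mate d) = FObj G (FObj (Fun T) d)"
  using assms by (auto simp: mate_def)

text \<open>Once \<open>G\<close> is collected, \<open>mate d\<close> has the shape that
  \<open>transpose_inverse\<close> undoes. This rule removes the mate from any transposed
  equation.\<close>

lemma transpose_mate:
  assumes [simp]: "d \<in> Obj (Cat T)"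
  shows "\<epsilon> (FObj (Fun T) d) \<cdot>\<^bsub>Cat T\<^esub> FArr F (mate d) =
    FArr (Fun T) (\<epsilon> d) \<cdot>\<^bsub>Cat T\<^esub> \<sigma> (FObj G d)"
  using transpose_inverse[of "FArr (Fun T) (\<epsilon> d) \<cdot>\<^bsub>Cat T\<^esub> \<sigma> (FObj G d)" "FObj (Fun S) (FObj G d)"]
  by (simp add: mate_def)

text \<open>Both transposes reduce to \<open>FArr (Fun T) g\<close> after
  \<open>FArr (Fun T) (\<epsilon> d)\<close> after \<open>\<sigma> (FObj G d)\<close>, with
  \<open>d\<close> the domain of \<open>g\<close>.\<close>

lemma mate_nat:
  assumes [simp]: "g \<in> Arr (Cat T)"
  shows "mate (Cod (Cat T) g) \<cdot>\<^bsub>Cat S\<^esub> FArr (Fun S) (FArr G g) =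
    FArr G (FArr (Fun T) g) \<cdot>\<^bsub>Cat S\<^esub> mate (Dom (Cat T) g)" (is "?l = ?r")
proof (rule transpose_cancel[where d = "FObj (Fun T) (Cod (Cat T) g)"])
  let ?d = "Dom (Cat T) g" and ?d' = "Cod (Cat T) g"
  have 1: "FArr (Fun T) (\<epsilon> ?d') \<cdot>\<^bsub>Cat T\<^esub> FArr (Fun T) (FArr F (FArr G g)) =
      FArr (Fun T) g \<cdot>\<^bsub>Cat T\<^esub> FArr (Fun T) (\<epsilon> ?d)"
    using arg_cong[OF counit_nat[of g], of "FArr (Fun T)"] by simp
  have 2: "\<epsilon> (FObj (Fun T) ?d') \<cdot>\<^bsub>Cat T\<^esub> FArr F (FArr G (FArr (Fun T) g)) =
      FArr (Fun T) g \<cdot>\<^bsub>Cat T\<^esub> \<epsilon> (FObj (Fun T) ?d)"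
    using counit_nat[of "FArr (Fun T) g"] by simp
  have 3: "\<sigma> (FObj G ?d') \<cdot>\<^bsub>Cat T\<^esub> FArr F (FArr (Fun S) (FArr G g)) =
      FArr (Fun T) (FArr F (FArr G g)) \<cdot>\<^bsub>Cat T\<^esub> \<sigma> (FObj G ?d)"
    using \<sigma>_nat[of "FArr G g"] by simp
  show "\<epsilon> (FObj (Fun T) ?d') \<cdot>\<^bsub>Cat T\<^esub> FArr F ?l = \<epsilon> (FObj (Fun T) ?d') \<cdot>\<^bsub>Cat T\<^esub> FArr F ?r"
    by (simp add: T.Cmp_reassoc[OF transpose_mate] T.Cmp_reassoc[OF 1] T.Cmp_reassoc[OF 2]
        transpose_mate 3)
qed auto

text \<open>Both transposes reduce to \<open>Unt T d \<cdot> \<epsilon> d\<close>.\<close>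

lemma mate_unit:
  assumes [simp]: "d \<in> Obj (Cat T)"
  shows "mate d \<cdot>\<^bsub>Cat S\<^esub> Unt S (FObj G d) = FArr G (Unt T d)" (is "?l = ?r")
proof (rule transpose_cancel[where d = "FObj (Fun T) d"])
  \<comment> \<open>The unit law of \<open>\<theta>\<close> is read backwards, which exposes a
    \<open>\<theta>\<close> for \<open>\<sigma>\<close> to cancel.\<close>
  have 1: "\<sigma> (FObj G d) \<cdot>\<^bsub>Cat T\<^esub> FArr F (Unt S (FObj G d)) = Unt T (FObj F (FObj G d))"
    by (simp add: unit[symmetric] T.Cmp_reassoc[OF \<sigma>_simps(4)])
  have 2: "FArr (Fun T) (\<epsilon> d) \<cdot>\<^bsub>Cat T\<^esub> Unt T (FObj F (FObj G d)) = Unt T d \<cdot>\<^bsub>Cat T\<^esub> \<epsilon> d"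
    using T.Unt.naturality_Arr[of "\<epsilon> d"] by simp
  show "\<epsilon> (FObj (Fun T) d) \<cdot>\<^bsub>Cat T\<^esub> FArr F ?l = \<epsilon> (FObj (Fun T) d) \<cdot>\<^bsub>Cat T\<^esub> FArr F ?r"
    using counit_nat[of "Unt T d"]
    by (simp add: T.Cmp_reassoc[OF transpose_mate] 1 2)
qed auto

text \<open>On the right side \<open>transpose_mate\<close> acts twice, first at
  \<open>FObj (Fun T) d\<close> and then at \<open>d\<close> under \<open>T\<close>. Naturality of
  \<open>Mul T\<close> at \<open>\<epsilon> d\<close> then brings it to the form that
  \<open>\<sigma>_mult\<close> gives on the left.\<close>

lemma mate_mult:
  assumes [simp]: "d \<in> Obj (Cat T)"
  shows "mate d \<cdot>\<^bsub>Cat S\<^esub> Mul S (FObj G d) = FArr G (Mul T d) \<cdot>\<^bsub>Cat S\<^esub> mate (FObj (Fun T) d) \<cdot>\<^bsub>Cat S\<^esub>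
    FArr (Fun S) (mate d)" (is "?l = ?r")
proof (rule transpose_cancel[where d = "FObj (Fun T) d"])
  let ?T = "FArr (Fun T)" and ?Td = "FObj (Fun T) d"
  have 1: "\<epsilon> ?Td \<cdot>\<^bsub>Cat T\<^esub> FArr F (FArr G (Mul T d)) = Mul T d \<cdot>\<^bsub>Cat T\<^esub> \<epsilon> (FObj (Fun T) ?Td)"
    using counit_nat[of "Mul T d"] by simp
  have 2: "\<sigma> (FObj G ?Td) \<cdot>\<^bsub>Cat T\<^esub> FArr F (FArr (Fun S) (mate d)) =
      ?T (FArr F (mate d)) \<cdot>\<^bsub>Cat T\<^esub> \<sigma> (FObj (Fun S) (FObj G d))"
    using \<sigma>_nat[of "mate d"] by simp
  have 3: "?T (\<epsilon> ?Td) \<cdot>\<^bsub>Cat T\<^esub> ?T (FArr F (mate d)) = ?T (?T (\<epsilon> d)) \<cdot>\<^bsub>Cat T\<^esub> ?T (\<sigma> (FObj G d))"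
    using arg_cong[OF transpose_mate[of d], of ?T] by simp
  have 4: "Mul T d \<cdot>\<^bsub>Cat T\<^esub> ?T (?T (\<epsilon> d)) = ?T (\<epsilon> d) \<cdot>\<^bsub>Cat T\<^esub> Mul T (FObj F (FObj G d))"
    using T.Mul.naturality_Arr[of "\<epsilon> d"] by simp
  show "\<epsilon> ?Td \<cdot>\<^bsub>Cat T\<^esub> FArr F ?l = \<epsilon> ?Td \<cdot>\<^bsub>Cat T\<^esub> FArr F ?r"
    by (simp add: T.Cmp_reassoc[OF transpose_mate] T.Cmp_reassoc[OF 1] 2 T.Cmp_reassoc[OF 3]
        T.Cmp_reassoc[OF 4] \<sigma>_mult)
qed auto

lemma one_cell_mate: "one_cell T S (G, mate)"
proof -
  have G: "cat_functor (Cat T) (Cat S) G" ..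
  have "nat_trans (Cat T) (Cat S) (Fun S \<circ>\<^sub>F G) (G \<circ>\<^sub>F Fun T) mate"
    by (rule nat_trans_intro)
      (auto simp: mate_nat intro: functor_comp G S.Fun_functor T.Fun_functor)
  then show ?thesis
    by (simp add: mate_unit mate_mult G S.monad_axioms T.monad_axioms)
qed

text \<open>The 2-cell law of the counit is \<open>transpose_mate\<close> followed by the
  cancellation of \<open>\<sigma>\<close> against \<open>\<theta>\<close>. That of the unit is
  checked by transposing: both sides become an identity.\<close>

lemma adjoint_object_mate: "adjoint_object S T (F, \<theta>) (G, mate) \<eta> \<epsilon>"
proof -
  have L: "one_cell S T (F, \<theta>)"
    by (simp only: one_cell_iff monad_morphism_axioms)
  have "FArr G (\<theta> x) \<cdot>\<^bsub>Cat S\<^esub> mate (FObj F x) \<cdot>\<^bsub>Cat S\<^esub> FArr (Fun S) (\<eta> x) = \<eta> (FObj (Fun S) x)"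
    (is "?l = ?r") if [simp]: "x \<in> Obj (Cat S)" for x
  proof (rule transpose_cancel[where d = "FObj F (FObj (Fun S) x)"])
    let ?d = "FObj F (FObj (Fun S) x)" and ?GF = "FObj G (FObj F x)"
    have 1: "\<epsilon> ?d \<cdot>\<^bsub>Cat T\<^esub> FArr F (FArr G (\<theta> x)) = \<theta> x \<cdot>\<^bsub>Cat T\<^esub> \<epsilon> (FObj (Fun T) (FObj F x))"
      using counit_nat[of "\<theta> x"] by simp
    have 2: "\<sigma> ?GF \<cdot>\<^bsub>Cat T\<^esub> FArr F (FArr (Fun S) (\<eta> x)) =
        FArr (Fun T) (FArr F (\<eta> x)) \<cdot>\<^bsub>Cat T\<^esub> \<sigma> x"
      using \<sigma>_nat[of "\<eta> x"] by simp
    have 3: "FArr (Fun T) (\<epsilon> (FObj F x)) \<cdot>\<^bsub>Cat T\<^esub> FArr (Fun T) (FArr F (\<eta> x)) =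
        Idn (Cat T) (FObj (Fun T) (FObj F x))"
      using arg_cong[OF triangle_left[of x], of "FArr (Fun T)"] by simp
    show "\<epsilon> ?d \<cdot>\<^bsub>Cat T\<^esub> FArr F ?l = \<epsilon> ?d \<cdot>\<^bsub>Cat T\<^esub> FArr F ?r"
      by (simp add: T.Cmp_reassoc[OF transpose_mate] T.Cmp_reassoc[OF 1] 2 T.Cmp_reassoc[OF 3]
          triangle_left)
  qed auto
  then have "two_cell S S (id_cell S) (comp_cell S (G, mate) (F, \<theta>)) \<eta>"
    using one_cell_id[OF S.monad_axioms] one_cell_comp[OF L one_cell_mate] \<eta>.nat_trans_axioms
    by (simp add: id_cell_def del: one_cell.simps)
  moreover have "two_cell T T (comp_cell T (F, \<theta>) (G, mate)) (id_cell T) \<epsilon>"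
    using one_cell_id[OF T.monad_axioms] one_cell_comp[OF one_cell_mate L] \<epsilon>.nat_trans_axioms
    by (simp add: id_cell_def T.Cmp_reassoc[OF transpose_mate] del: one_cell.simps)
  ultimately show ?thesis
    using L one_cell_mate adjoint_pair_axioms
    by (simp add: adjoint_object_def adjunction_iff del: one_cell.simps two_cell.simps)
qed

end

section \<open>Hopf parametric adjunctions\<close>

locale hopf_parametric_adjunction = S: monad S + T: monad T + E: monad E
  for S :: "('oc, 'ac) mnd" and T :: "('od, 'ad) mnd" and E :: "('op, 'ap) mnd" +
  fixes J :: "('oc \<times> 'op, 'ac \<times> 'ap, 'od, 'ad) ftor"
    and K :: "('op \<times> 'od, 'ap \<times> 'ad, 'oc, 'ac) ftor"
    and \<eta> :: "'op \<Rightarrow> 'oc \<Rightarrow> 'ac" and \<epsilon> :: "'op \<Rightarrow> 'od \<Rightarrow> 'ad"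
    and \<psi>J :: "'oc \<times> 'op \<Rightarrow> 'ad"
  assumes param_adj: "parametric_adjunction (Cat S) (Cat E) (Cat T) J K \<eta> \<epsilon>"
    and one_cell_J: "one_cell (prod_mnd S E) T (J, \<psi>J)"
    and left_hopf: "left_hopf S E T (J, \<psi>J)"
begin

abbreviation H where "H \<equiv> hopf_map S T (J, \<psi>J)"
abbreviation psiJ where "psiJ \<equiv> psi_J S T (J, \<psi>J)"
abbreviation psiK where "psiK \<equiv> psi_K S E T (J, \<psi>J) K \<eta> \<epsilon>"
abbreviation left_fibre where "left_fibre M \<equiv> fix_right (Cat E) J M"
abbreviation right_fibre where "right_fibre M \<equiv> fix_left (op_cat (Cat E)) K M"

sublocale J: monad_morphism "prod_mnd S E" T J \<psi>J
  using one_cell_J by (simp only: one_cell_iff)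

sublocale K: cat_functor "prod_cat (op_cat (Cat E)) (Cat T)" "Cat S" K
  using param_adj by (simp add: parametric_adjunction_def)

lemma adjoint_pair_fibre:
  "M \<in> Obj (Cat E) \<Longrightarrow>
     adjoint_pair (Cat S) (Cat T) (left_fibre M) (right_fibre M) (\<eta> M) (\<epsilon> M)"
  using param_adj by (simp add: parametric_adjunction_def adjunction_iff)

text \<open>Oriented from two factors to one arrow, so that composites which differ by interchanging
  the two slots of \<open>J\<close> become equal once merged.\<close>

lemma J_Cmp:
  assumes "a \<in> Arr (Cat S)" "a' \<in> Arr (Cat S)" "Dom (Cat S) a' = Cod (Cat S) a"
    and "b \<in> Arr (Cat E)" "b' \<in> Arr (Cat E)" "Dom (Cat E) b' = Cod (Cat E) b"
  shows "FArr J (a', b') \<cdot>\<^bsub>Cat T\<^esub> FArr J (a, b) = FArr J (a' \<cdot>\<^bsub>Cat S\<^esub> a, b' \<cdot>\<^bsub>Cat E\<^esub> b)"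
  using J.B.FArr_simps(6)[of "(a, b)" "(a', b')"] assms by simp

text \<open>The first slot of \<open>K\<close> lives in the opposite category, hence the reversed
  order of \<open>b\<close> and \<open>b'\<close>.\<close>

lemma K_Cmp:
  assumes "b \<in> Arr (Cat E)" "b' \<in> Arr (Cat E)" "Cod (Cat E) b' = Dom (Cat E) b"
    and "g \<in> Arr (Cat T)" "g' \<in> Arr (Cat T)" "Dom (Cat T) g' = Cod (Cat T) g"
  shows "FArr K (b', g') \<cdot>\<^bsub>Cat S\<^esub> FArr K (b, g) = FArr K (b \<cdot>\<^bsub>Cat E\<^esub> b', g' \<cdot>\<^bsub>Cat T\<^esub> g)"
  using K.FArr_simps(6)[of "(b, g)" "(b', g')"] assms by simp

section \<open>The Hopf map as a morphism of monads\<close>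

lemma H_apply: "H (c, (M, k)) =
    FArr J (Idn (Cat S) (FObj (Fun S) c), k) \<cdot>\<^bsub>Cat T\<^esub> \<psi>J (c, M)"
  by (simp add: hopf_map_def)

text \<open>Joint naturality in the object and the algebra is contained in
  \<open>invertible_trans\<close>, hence in the left Hopf hypothesis.\<close>

sublocale H: nat_trans "prod_cat (Cat S) (EM_cat E)" "Cat T"
    "Fun T \<circ>\<^sub>F J \<circ>\<^sub>F (id_ftor \<times>\<^sub>F EM_forget)" "J \<circ>\<^sub>F (Fun S \<times>\<^sub>F EM_forget)" H
  using left_hopf by (simp add: left_hopf_def invertible_trans_def)

lemma H_inverse:
  assumes "c \<in> Obj (Cat S)" "A \<in> EM_algebras E"
  shows "\<exists>g. inverse_arrows (Cat T) (H (c, A)) g"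
proof -
  obtain \<sigma> where \<sigma>: "nat_trans (prod_cat (Cat S) (EM_cat E)) (Cat T) (J \<circ>\<^sub>F (Fun S \<times>\<^sub>F EM_forget))
      (Fun T \<circ>\<^sub>F J \<circ>\<^sub>F (id_ftor \<times>\<^sub>F EM_forget)) \<sigma>"
    "\<forall>x \<in> Obj (prod_cat (Cat S) (EM_cat E)).
      \<sigma> x \<cdot>\<^bsub>Cat T\<^esub> H x = Idn (Cat T) (FObj (Fun T \<circ>\<^sub>F J \<circ>\<^sub>F (id_ftor \<times>\<^sub>F EM_forget)) x) \<and>
      H x \<cdot>\<^bsub>Cat T\<^esub> \<sigma> x = Idn (Cat T) (FObj (J \<circ>\<^sub>F (Fun S \<times>\<^sub>F EM_forget)) x)"
    using left_hopf by (auto simp: left_hopf_def invertible_trans_def)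
  interpret \<sigma>: nat_trans "prod_cat (Cat S) (EM_cat E)" "Cat T" "J \<circ>\<^sub>F (Fun S \<times>\<^sub>F EM_forget)"
    "Fun T \<circ>\<^sub>F J \<circ>\<^sub>F (id_ftor \<times>\<^sub>F EM_forget)" \<sigma>
    by (rule \<sigma>)
  have "inverse_arrows (Cat T) (H (c, A)) (\<sigma> (c, A))"
    using \<sigma>(2)[rule_format, of "(c, A)"] assms by (simp add: inverse_arrows_def Hom_def)
  then show ?thesis ..
qed

text \<open>The unit law of \<open>\<psi>J\<close> produces \<open>Unt E M\<close> in the second
  slot, which the unit law of the algebra absorbs into \<open>k\<close>.\<close>

lemma H_unit:
  assumes [simp]: "c \<in> Obj (Cat S)" and A: "(M, k) \<in> EM_algebras E"
  shows "H (c, (M, k)) \<cdot>\<^bsub>Cat T\<^esub> Unt T (FObj J (c, M)) = FArr J (Unt S c, Idn (Cat E) M)"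
proof -
  note [simp] = E.EM_algebraD[OF A]
  show ?thesis
    using J.unit[of "(c, M)"] by (simp add: H_apply J_Cmp)
qed

text \<open>The multiplication law of \<open>\<psi>J\<close> leaves \<open>Mul E M\<close> under
  \<open>k\<close>. Associativity of the algebra turns this into two copies of \<open>k\<close>, and
  naturality of \<open>\<psi>J\<close> carries one of them under \<open>T\<close>.\<close>

lemma H_mult:
  assumes [simp]: "c \<in> Obj (Cat S)" and A: "(M, k) \<in> EM_algebras E"
  shows "H (c, (M, k)) \<cdot>\<^bsub>Cat T\<^esub> Mul T (FObj J (c, M)) =
    FArr J (Mul S c, Idn (Cat E) M) \<cdot>\<^bsub>Cat T\<^esub> H (FObj (Fun S) c, (M, k)) \<cdot>\<^bsub>Cat T\<^esub>
    FArr (Fun T) (H (c, (M, k)))"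
proof -
  note [simp] = E.EM_algebraD(1-4)[OF A]
  let ?S = "FObj (Fun S)" and ?E = "FObj (Fun E)" and ?I = "Idn (Cat S)"
  have mult: "\<psi>J (c, M) \<cdot>\<^bsub>Cat T\<^esub> Mul T (FObj J (c, M)) =
      FArr J (Mul S c, Mul E M) \<cdot>\<^bsub>Cat T\<^esub> \<psi>J (?S c, ?E M) \<cdot>\<^bsub>Cat T\<^esub> FArr (Fun T) (\<psi>J (c, M))"
    using J.mult[of "(c, M)"] by simp
  have nat: "\<psi>J (?S c, M) \<cdot>\<^bsub>Cat T\<^esub> FArr (Fun T) (FArr J (?I (?S c), k)) =
      FArr J (?I (?S (?S c)), FArr (Fun E) k) \<cdot>\<^bsub>Cat T\<^esub> \<psi>J (?S c, ?E M)"
    using J.\<psi>.naturality_Arr[of "(?I (?S c), k)"] by simp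
  have merge: "FArr J (Mul S c, Idn (Cat E) M) \<cdot>\<^bsub>Cat T\<^esub> FArr J (?I (?S (?S c)), k) =
      FArr J (Mul S c, k)"
    by (simp add: J_Cmp)
  have swap: "FArr J (?I (?S c), k) \<cdot>\<^bsub>Cat T\<^esub> FArr J (Mul S c, Mul E M) =
      FArr J (Mul S c, k) \<cdot>\<^bsub>Cat T\<^esub> FArr J (?I (?S (?S c)), FArr (Fun E) k)"
    by (simp add: J_Cmp E.EM_algebraD(6)[OF A])
  show ?thesis
    by (simp add: H_apply mult T.Cmp_reassoc[OF nat] T.Cmp_reassoc[OF merge] T.Cmp_reassoc[OF swap])
qed

lemma one_cell_H:
  "one_cell (prod_mnd S (id_mnd (EM_cat E))) T (J \<circ>\<^sub>F (id_ftor \<times>\<^sub>F EM_forget), H)"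
proof -
  \<comment> \<open>\<open>H\<close> was given a codomain functor in which \<open>Fun S\<close> and
    \<open>EM_forget\<close> form one product. A 1-cell needs it as a composite ending in the monad
    functor; the two agree as records.\<close>
  have "(J \<circ>\<^sub>F (id_ftor \<times>\<^sub>F EM_forget)) \<circ>\<^sub>F (Fun S \<times>\<^sub>F id_ftor) =
      J \<circ>\<^sub>F (Fun S \<times>\<^sub>F (EM_forget :: ('op \<times> 'ap, ('op \<times> 'ap) \<times> 'ap \<times> 'op \<times> 'ap, 'op, 'ap) ftor))"
    by (simp add: comp_ftor_def prod_ftor_def id_ftor_def fun_eq_iff)
  then have "nat_trans (prod_cat (Cat S) (EM_cat E)) (Cat T) (Fun T \<circ>\<^sub>F J \<circ>\<^sub>F (id_ftor \<times>\<^sub>F EM_forget))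
      ((J \<circ>\<^sub>F (id_ftor \<times>\<^sub>F EM_forget)) \<circ>\<^sub>F (Fun S \<times>\<^sub>F id_ftor)) H"
    using H.nat_trans_axioms by simp
  moreover have "cat_functor (prod_cat (Cat S) (Cat E)) (Cat T) J"
    using J.B.cat_functor_axioms by simp
  then have "cat_functor (prod_cat (Cat S) (EM_cat E)) (Cat T) (J \<circ>\<^sub>F (id_ftor \<times>\<^sub>F EM_forget))"
    by (rule functor_comp[OF functor_prod[OF functor_id[OF S.Cat_category] E.functor_EM_forget]])
  ultimately show ?thesis
    by (auto simp: monad_prod monad_id S.monad_axioms T.monad_axioms E.category_EM H_unit H_mult)
qed

lemma strong_left_adjoint_fibre:
  assumes A: "(M, k) \<in> EM_algebras E"
  shows "strong_left_adjoint S T (left_fibre M) (psiJ (M, k)) (right_fibre M) (\<eta> M) (\<epsilon> M)"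
proof -
  note [simp] = A E.EM_algebraD(1-4)[OF A]
  interpret adjoint_pair "Cat S" "Cat T" "left_fibre M" "right_fibre M" "\<eta> M" "\<epsilon> M"
    by (rule adjoint_pair_fibre) simp
  have F: "cat_functor (Cat S) (Cat T) (left_fibre M)" ..
  \<comment> \<open>Naturality of \<open>H\<close> is taken at \<open>f\<close> paired with the
    identity of the algebra, whose underlying arrow is the \<open>Idn (Cat E) M\<close> used by
    \<open>left_fibre M\<close>.\<close>
  have "psiJ (M, k) (Cod (Cat S) f) \<cdot>\<^bsub>Cat T\<^esub> FArr (Fun T) (FArr J (f, Idn (Cat E) M)) =
      FArr J (FArr (Fun S) f, Idn (Cat E) M) \<cdot>\<^bsub>Cat T\<^esub> psiJ (M, k) (Dom (Cat S) f)"
    if "f \<in> Arr (Cat S)" for f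
    using that H.naturality_Arr[of "(f, Idn (EM_cat E) (M, k))"]
    by (simp add: psi_J_def E.EM_arrow_iff)
  then have "nat_trans (Cat S) (Cat T) (Fun T \<circ>\<^sub>F left_fibre M) (left_fibre M \<circ>\<^sub>F Fun S) (psiJ (M, k))"
    by (intro nat_trans_intro functor_comp[OF F T.Fun_functor] functor_comp[OF S.Fun_functor F])
      (auto simp: psi_J_def)
  then interpret nat_trans "Cat S" "Cat T" "Fun T \<circ>\<^sub>F left_fibre M" "left_fibre M \<circ>\<^sub>F Fun S"
    "psiJ (M, k)" .
  show ?thesis
    by unfold_locales (auto simp: psi_J_def H_unit H_mult H_inverse)
qed

lemma mate_fibre:
  assumes "(M, k) \<in> EM_algebras E"
  shows "strong_left_adjoint.mate S T (psiJ (M, k)) (right_fibre M) (\<eta> M) (\<epsilon> M) = psiK (M, k)"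
proof -
  interpret strong_left_adjoint S T "left_fibre M" "psiJ (M, k)" "right_fibre M" "\<eta> M" "\<epsilon> M"
    using assms by (rule strong_left_adjoint_fibre)
  show ?thesis by (rule ext) (simp add: mate_def psi_K_def Let_def)
qed

section \<open>Naturality in the algebra\<close>

lemma counit_dinatural:
  assumes [simp]: "f \<in> Arr (Cat E)" "d \<in> Obj (Cat T)"
    and M: "Dom (Cat E) f = M" and N: "Cod (Cat E) f = N"
  shows "\<epsilon> M d \<cdot>\<^bsub>Cat T\<^esub> FArr J (FArr K (f, Idn (Cat T) d), Idn (Cat E) M) =
    \<epsilon> N d \<cdot>\<^bsub>Cat T\<^esub> FArr J (Idn (Cat S) (FObj K (N, d)), f)"
proof -
  note [simp] = M N
  have [simp]: "M \<in> Obj (Cat E)" "N \<in> Obj (Cat E)" by (auto simp flip: M N)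
  interpret M: adjoint_pair "Cat S" "Cat T" "left_fibre M" "right_fibre M" "\<eta> M" "\<epsilon> M"
    by (rule adjoint_pair_fibre) simp
  interpret N: adjoint_pair "Cat S" "Cat T" "left_fibre N" "right_fibre N" "\<eta> N" "\<epsilon> N"
    by (rule adjoint_pair_fibre) simp
  \<comment> \<open>The formula for \<open>K\<close> on parameter arrows says that
    \<open>FArr K (f, Idn (Cat T) d)\<close> corresponds to \<open>?u\<close> under the adjunction
    at \<open>M\<close>; transposing back returns \<open>?u\<close>.\<close>
  let ?u = "\<epsilon> N d \<cdot>\<^bsub>Cat T\<^esub> FArr J (Idn (Cat S) (FObj K (N, d)), f)"
  have "FArr K (f, Idn (Cat T) d) =
      FArr (right_fibre M) (\<epsilon> N d) \<cdot>\<^bsub>Cat S\<^esub>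
      FArr (right_fibre M) (FArr J (Idn (Cat S) (FObj K (N, d)), f)) \<cdot>\<^bsub>Cat S\<^esub> \<eta> M (FObj K (N, d))"
    using param_adj by (simp add: parametric_adjunction_def Hom_def)
  also have "\<dots> = FArr (right_fibre M) ?u \<cdot>\<^bsub>Cat S\<^esub> \<eta> M (FObj K (N, d))"
    by (subst M.G.FArr_simps(6)) auto
  finally show ?thesis
    using M.transpose_inverse[of ?u "FObj K (N, d)"] by simp
qed

text \<open>Both composites are transposed along the fibre at \<open>M\<close>. The common value
  involves only \<open>\<epsilon> N d\<close>, the arrow \<open>f\<close> in the second slot of
  \<open>J\<close>, and the inverse of the Hopf map at \<open>(M, k)\<close>.\<close>

lemma psiK_EM_natural:
  assumes f: "((M, k), f, (N, l)) \<in> EM_arrows E" and [simp]: "d \<in> Obj (Cat T)"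
  shows "psiK (M, k) d \<cdot>\<^bsub>Cat S\<^esub> FArr (Fun S) (FArr K (f, Idn (Cat T) d)) =
    FArr K (f, Idn (Cat T) (FObj (Fun T) d)) \<cdot>\<^bsub>Cat S\<^esub> psiK (N, l) d"
    (is "?w \<cdot>\<^bsub>Cat S\<^esub> FArr (Fun S) ?h = ?h' \<cdot>\<^bsub>Cat S\<^esub> ?w'")
proof -
  have A: "(M, k) \<in> EM_algebras E" and B: "(N, l) \<in> EM_algebras E"
    and f' [simp]: "f \<in> Arr (Cat E)" "Dom (Cat E) f = M" "Cod (Cat E) f = N"
    using f by (auto simp: E.EM_arrow_iff)
  note [simp] = A B f E.EM_algebraD(1-4)[OF A] E.EM_algebraD(1-4)[OF B]
  interpret A: strong_left_adjoint S T "left_fibre M" "psiJ (M, k)" "right_fibre M" "\<eta> M" "\<epsilon> M"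
    using A by (rule strong_left_adjoint_fibre)
  interpret B: strong_left_adjoint S T "left_fibre N" "psiJ (N, l)" "right_fibre N" "\<eta> N" "\<epsilon> N"
    using B by (rule strong_left_adjoint_fibre)
  note [simp] = mate_fibre[OF A] mate_fibre[OF B]
  \<comment> \<open>\<open>mate_fibre\<close> rewrites mates to \<open>psiK\<close>, so the typing
    rules are restated for that name.\<close>
  note [simp] = A.mate_simps[of d, simplified] B.mate_simps[of d, simplified]
  let ?T = "FArr (Fun T)" and ?Td = "FObj (Fun T) d" and ?x = "FObj K (N, d)"
    and ?I = "Idn (Cat S)" and ?M = "Idn (Cat E) M" and ?N = "Idn (Cat E) N"
  have left: "\<epsilon> M ?Td \<cdot>\<^bsub>Cat T\<^esub> FArr J (?w \<cdot>\<^bsub>Cat S\<^esub> FArr (Fun S) ?h, ?M) =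
      ?T (\<epsilon> N d) \<cdot>\<^bsub>Cat T\<^esub> ?T (FArr J (?I ?x, f)) \<cdot>\<^bsub>Cat T\<^esub> A.\<sigma> ?x"
  proof -
    have split: "FArr J (?w \<cdot>\<^bsub>Cat S\<^esub> FArr (Fun S) ?h, ?M) =
        FArr J (?w, ?M) \<cdot>\<^bsub>Cat T\<^esub> FArr J (FArr (Fun S) ?h, ?M)"
      by (simp add: J_Cmp)
    have 1: "\<epsilon> M ?Td \<cdot>\<^bsub>Cat T\<^esub> FArr J (?w, ?M) = ?T (\<epsilon> M d) \<cdot>\<^bsub>Cat T\<^esub> A.\<sigma> (FObj K (M, d))"
      using A.transpose_mate[of d] by simp
    have 2: "A.\<sigma> (FObj K (M, d)) \<cdot>\<^bsub>Cat T\<^esub> FArr J (FArr (Fun S) ?h, ?M) =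
        ?T (FArr J (?h, ?M)) \<cdot>\<^bsub>Cat T\<^esub> A.\<sigma> ?x"
      using A.\<sigma>_nat[of ?h] by simp
    have 3: "?T (\<epsilon> M d) \<cdot>\<^bsub>Cat T\<^esub> ?T (FArr J (?h, ?M)) = ?T (\<epsilon> N d) \<cdot>\<^bsub>Cat T\<^esub> ?T (FArr J (?I ?x, f))"
      using arg_cong[OF counit_dinatural[OF f'(1) _ f'(2,3), of d], of ?T] by simp
    show ?thesis
      by (simp add: split T.Cmp_reassoc[OF 1] 2 T.Cmp_reassoc[OF 3])
  qed
  have right: "\<epsilon> M ?Td \<cdot>\<^bsub>Cat T\<^esub> FArr J (?h' \<cdot>\<^bsub>Cat S\<^esub> ?w', ?M) =
      ?T (\<epsilon> N d) \<cdot>\<^bsub>Cat T\<^esub> ?T (FArr J (?I ?x, f)) \<cdot>\<^bsub>Cat T\<^esub> A.\<sigma> ?x"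
  proof -
    have split: "FArr J (?h' \<cdot>\<^bsub>Cat S\<^esub> ?w', ?M) = FArr J (?h', ?M) \<cdot>\<^bsub>Cat T\<^esub> FArr J (?w', ?M)"
      by (simp add: J_Cmp)
    have 1: "\<epsilon> M ?Td \<cdot>\<^bsub>Cat T\<^esub> FArr J (?h', ?M) =
        \<epsilon> N ?Td \<cdot>\<^bsub>Cat T\<^esub> FArr J (?I (FObj K (N, ?Td)), f)"
      by (rule counit_dinatural) auto
    \<comment> \<open>Interchange moves \<open>f\<close> past \<open>?w'\<close>, which can then be
      transposed in its own fibre, at \<open>N\<close>.\<close>
    have 2: "FArr J (?I (FObj K (N, ?Td)), f) \<cdot>\<^bsub>Cat T\<^esub> FArr J (?w', ?M) =
        FArr J (?w', ?N) \<cdot>\<^bsub>Cat T\<^esub> FArr J (?I (FObj (Fun S) ?x), f)"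
      by (simp add: J_Cmp)
    have 3: "\<epsilon> N ?Td \<cdot>\<^bsub>Cat T\<^esub> FArr J (?w', ?N) = ?T (\<epsilon> N d) \<cdot>\<^bsub>Cat T\<^esub> B.\<sigma> ?x"
      using B.transpose_mate[of d] by simp
    \<comment> \<open>This is naturality of the Hopf map along the algebra morphism alone; inverting
      its two Hopf sides exchanges \<open>B.\<sigma>\<close> for \<open>A.\<sigma>\<close>.\<close>
    have "psiJ (N, l) ?x \<cdot>\<^bsub>Cat T\<^esub> ?T (FArr J (?I ?x, f)) =
        FArr J (?I (FObj (Fun S) ?x), f) \<cdot>\<^bsub>Cat T\<^esub> psiJ (M, k) ?x"
      using H.naturality_Arr[of "(?I ?x, ((M, k), f, (N, l)))"] by (simp add: psi_J_def)
    then have 4: "B.\<sigma> ?x \<cdot>\<^bsub>Cat T\<^esub> FArr J (?I (FObj (Fun S) ?x), f) =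
        ?T (FArr J (?I ?x, f)) \<cdot>\<^bsub>Cat T\<^esub> A.\<sigma> ?x"
      by (intro T.inverse_arrows_square[OF A.inverse B.inverse]) (auto simp: Hom_def)
    show ?thesis
      by (simp add: split T.Cmp_reassoc[OF 1] 2 T.Cmp_reassoc[OF 3] 4)
  qed
  show ?thesis
    by (rule A.transpose_cancel[where d = ?Td]) (use left right in auto)
qed

text \<open>The monad on the algebra factor is the identity, so the unit and multiplication laws
  hold fibre by fibre. Only naturality mixes the two variables.\<close>

lemma one_cell_psiK:
  "one_cell (prod_mnd (id_mnd (op_cat (EM_cat E))) T) S
    (K \<circ>\<^sub>F (op_ftor EM_forget \<times>\<^sub>F id_ftor), \<lambda>(A, d). psiK A d)"
proof -
  \<comment> \<open>\<open>op_ftor\<close> does not change the underlying record, so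
    \<open>?K\<close> omits it; the variance is recorded by \<open>op_cat\<close>.\<close>
  let ?P = "prod_cat (op_cat (EM_cat E)) (Cat T)" and ?K = "K \<circ>\<^sub>F (EM_forget \<times>\<^sub>F id_ftor)"
  have K: "cat_functor ?P (Cat S) ?K"
    by (intro functor_comp[OF _ K.cat_functor_axioms] functor_prod functor_op functor_id
        T.Cat_category E.functor_EM_forget)
  have fibre: "one_cell T S (right_fibre M, psiK (M, k))" if "(M, k) \<in> EM_algebras E" for M k
    using strong_left_adjoint.one_cell_mate[OF strong_left_adjoint_fibre[OF that]]
    by (simp only: mate_fibre[OF that])
  have "nat_trans ?P (Cat S) (Fun S \<circ>\<^sub>F ?K) (?K \<circ>\<^sub>F (id_ftor \<times>\<^sub>F Fun T)) (\<lambda>(A, d). psiK A d)"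
  proof (rule nat_trans_intro)
    show "cat_functor ?P (Cat S) (Fun S \<circ>\<^sub>F ?K)"
      by (rule functor_comp[OF K S.Fun_functor])
    show "cat_functor ?P (Cat S) (?K \<circ>\<^sub>F (id_ftor \<times>\<^sub>F Fun T))"
      by (intro functor_comp[OF _ K] functor_prod functor_id T.Fun_functor category_op
          E.category_EM)
  next
    fix x assume "x \<in> Obj ?P"
    then obtain M k d where x: "x = ((M, k), d)" "(M, k) \<in> EM_algebras E" "d \<in> Obj (Cat T)"
      by auto
    then interpret monad_morphism T S "right_fibre M" "psiK (M, k)"
      using fibre by (simp only: one_cell_iff)
    show "(\<lambda>(A, d). psiK A d) x \<in> Arr (Cat S) \<and>
        Dom (Cat S) ((\<lambda>(A, d). psiK A d) x) = FObj (Fun S \<circ>\<^sub>F ?K) x \<and>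
        Cod (Cat S) ((\<lambda>(A, d). psiK A d) x) = FObj (?K \<circ>\<^sub>F (id_ftor \<times>\<^sub>F Fun T)) x"
      using x by simp
  next
    fix p assume "p \<in> Arr ?P"
    then obtain M k f N l g where p: "p = (((M, k), f, (N, l)), g)"
      and f: "((M, k), f, (N, l)) \<in> EM_arrows E" and g [simp]: "g \<in> Arr (Cat T)"
      by auto
    have A: "(M, k) \<in> EM_algebras E" and B: "(N, l) \<in> EM_algebras E"
      and [simp]: "f \<in> Arr (Cat E)" "Dom (Cat E) f = M" "Cod (Cat E) f = N"
      using f by (auto simp: E.EM_arrow_iff)
    note [simp] = E.EM_algebraD(1)[OF A] E.EM_algebraD(1)[OF B]
    interpret A: monad_morphism T S "right_fibre M" "psiK (M, k)"
      using fibre[OF A] by (simp only: one_cell_iff)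
    interpret B: monad_morphism T S "right_fibre N" "psiK (N, l)"
      using fibre[OF B] by (simp only: one_cell_iff)
    let ?d = "Dom (Cat T) g" and ?d' = "Cod (Cat T) g" and ?M = "Idn (Cat E) M"
    \<comment> \<open>An arrow of the product is split into a parameter arrow followed by one in the
      fibre at \<open>M\<close>, so joint naturality follows from naturality in each
      variable.\<close>
    have split: "FArr K (f, g) = FArr K (?M, g) \<cdot>\<^bsub>Cat S\<^esub> FArr K (f, Idn (Cat T) ?d)"
      "FArr K (f, FArr (Fun T) g) =
        FArr K (?M, FArr (Fun T) g) \<cdot>\<^bsub>Cat S\<^esub> FArr K (f, Idn (Cat T) (FObj (Fun T) ?d))"
      by (simp_all add: K_Cmp)
    have 1: "psiK (M, k) ?d' \<cdot>\<^bsub>Cat S\<^esub> FArr (Fun S) (FArr K (?M, g)) =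
        FArr K (?M, FArr (Fun T) g) \<cdot>\<^bsub>Cat S\<^esub> psiK (M, k) ?d"
      using A.\<psi>.naturality_Arr[of g] by simp
    have typed: "psiK (M, k) d \<in> Arr (Cat S)"
      "Dom (Cat S) (psiK (M, k) d) = FObj (Fun S) (FObj K (M, d))"
      "psiK (N, l) d \<in> Arr (Cat S)"
      "Cod (Cat S) (psiK (N, l) d) = FObj K (N, FObj (Fun T) d)" if "d \<in> Obj (Cat T)" for d
      using that by simp_all
    show "(\<lambda>(A, d). psiK A d) (Cod ?P p) \<cdot>\<^bsub>Cat S\<^esub> FArr (Fun S \<circ>\<^sub>F ?K) p =
        FArr (?K \<circ>\<^sub>F (id_ftor \<times>\<^sub>F Fun T)) p \<cdot>\<^bsub>Cat S\<^esub> (\<lambda>(A, d). psiK A d) (Dom ?P p)"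
      by (simp add: p split S.Cmp_reassoc[OF 1] psiK_EM_natural[OF f] typed)
  qed
  moreover have "psiK A d \<cdot>\<^bsub>Cat S\<^esub> Mul S (FObj K (fst A, d)) =
      FArr K (Idn (Cat E) (fst A), Mul T d) \<cdot>\<^bsub>Cat S\<^esub> psiK A (FObj (Fun T) d) \<cdot>\<^bsub>Cat S\<^esub>
      FArr (Fun S) (psiK A d)"
    "psiK A d \<cdot>\<^bsub>Cat S\<^esub> Unt S (FObj K (fst A, d)) = FArr K (Idn (Cat E) (fst A), Unt T d)"
    if "A \<in> EM_algebras E" "d \<in> Obj (Cat T)" for A d
    using fibre[of "fst A" "snd A"] that by simp_all
  ultimately show ?thesis
    by (auto simp: K monad_prod monad_id category_op S.monad_axioms T.monad_axioms E.category_EM)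
qed

lemma adjoint_object_fibre:
  assumes "(M, k) \<in> EM_algebras E"
  shows "adjoint_object S T (left_fibre M, psiJ (M, k)) (right_fibre M, psiK (M, k)) (\<eta> M) (\<epsilon> M)"
  using strong_left_adjoint.adjoint_object_mate[OF strong_left_adjoint_fibre[OF assms]]
  by (simp only: mate_fibre[OF assms])

end

theorem theorem4p1p6:
  fixes S :: "('oc, 'ac) mnd"
    and T :: "('od, 'ad) mnd"
    and E :: "('op, 'ap) mnd"
    and J :: "('oc \<times> 'op, 'ac \<times> 'ap, 'od, 'ad) ftor"
    and K :: "('op \<times> 'od, 'ap \<times> 'ad, 'oc, 'ac) ftor"
    and \<eta> :: "'op \<Rightarrow> 'oc \<Rightarrow> 'ac"
    and \<epsilon> :: "'op \<Rightarrow> 'od \<Rightarrow> 'ad"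
    and \<psi>J :: "'oc \<times> 'op \<Rightarrow> 'ad"
  assumes "monad S" and "monad T" and "monad E"
    and "parametric_adjunction (Cat S) (Cat E) (Cat T) J K \<eta> \<epsilon>"
    and "one_cell (prod_mnd S E) T (J, \<psi>J)"
    and "left_hopf S E T (J, \<psi>J)"
  shows "one_cell (prod_mnd S (id_mnd (EM_cat E))) T
           (J \<circ>\<^sub>F (id_ftor \<times>\<^sub>F EM_forget), hopf_map S T (J, \<psi>J))
       \<and> one_cell (prod_mnd (id_mnd (op_cat (EM_cat E))) T) S
           (K \<circ>\<^sub>F (op_ftor EM_forget \<times>\<^sub>F id_ftor),
            \<lambda>(A, d). psi_K S E T (J, \<psi>J) K \<eta> \<epsilon> A d)
       \<and> (\<forall>(M, k) \<in> Obj (EM_cat E).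
            adjoint_object S T
              (fix_right (Cat E) J M, psi_J S T (J, \<psi>J) (M, k))
              (fix_left (op_cat (Cat E)) K M, psi_K S E T (J, \<psi>J) K \<eta> \<epsilon> (M, k))
              (\<eta> M) (\<epsilon> M))"
proof -
  interpret hopf_parametric_adjunction S T E J K \<eta> \<epsilon> \<psi>J
    using assms by (simp add: hopf_parametric_adjunction_def hopf_parametric_adjunction_axioms_def)
  show ?thesis
    using one_cell_H one_cell_psiK adjoint_object_fibre by (auto simp del: one_cell.simps)
qed

end
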